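(* Let $K$ be an imaginary quadratic field with ring of integers $\mathscr{O}_K$. Let $\alpha,\beta\in\mathscr{O}_K$ be nonzero, and suppose neither is a root of unity. Then there are infinitely many prime ideals $P$ of $\mathscr{O}_K$ (not dividing $\alpha\beta$) for which $\alpha \bmod P$ and $\beta\bmod P$ generate the same subgroup of $(\mathscr{O}_K/P)^{\times}$. *)

theory Defs
  imports
    "HOL-Algebra.Algebra"
    "HOL-Algebra.Algebraic_Closure_Type"
    "HOL-Computational_Algebra.Polynomial"
begin

text \<open>
  A field of characteristic 0 is represented as a subfield \<open>K\<close> of an arbitrary type of class
  \<open>field_char_0\<close>. Taking \<open>K = UNIV\<close> covers abstract fields, taking the type to be
  \<open>complex\<close> covers subfields of the complex numbers. The set \<open>\<rat>\<close> is then the prime field.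
\<close>

text \<open>
  A quadratic field is imaginary if it has no real embedding. An element of \<open>ring_hom\<close> is only
  constrained on the carrier of the domain, so emptiness says exactly that no homomorphism exists.
\<close>

definition imaginary_quadratic_field :: "'a::field_char_0 set \<Rightarrow> bool" where
  "imaginary_quadratic_field K \<longleftrightarrow>
     subfield K ring_of_type_algebra \<and>
     ring.dimension ring_of_type_algebra 2 \<rat> K \<and>
     ring_hom (ring_of_type_algebra\<lparr>carrier := K\<rparr>) (ring_of_type_algebra :: real ring) = {}"

definition ring_of_integers :: "'a::field_char_0 set \<Rightarrow> 'a ring" where
  "ring_of_integers K = ring_of_type_algebra\<lparr>carrier := {x \<in> K. algebraic_int x}\<rparr>"

definition root_of_unity :: "'a::monoid_mult \<Rightarrow> bool" where
  "root_of_unity x \<longleftrightarrow> (\<exists>n::nat. n > 0 \<and> x ^ n = 1)"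

text \<open>
  The subgroup of the unit group of \<open>R / P\<close> generated by the class of \<open>x\<close>.
  It is only meaningful if that class is a unit.
\<close>

definition residue_subgroup :: "'a ring \<Rightarrow> 'a set \<Rightarrow> 'a \<Rightarrow> 'a set set" where
  "residue_subgroup R P x = generate (units_of (R Quot P)) {P +>\<^bsub>R\<^esub> x}"

end

theory Submission
  imports Defs
begin

text \<open>
  Suppose that only finitely many primes are as wanted. For a prime number \<open>q\<close> put
  \<open>g = \<alpha> ^ q - \<beta>\<close>. If a prime ideal \<open>P\<close> divides \<open>g\<close> and \<open>q\<close> is coprime to the order of \<open>\<alpha>\<close>
  modulo \<open>P\<close>, then \<open>\<alpha>\<close> and \<open>\<beta>\<close> generate the same subgroup modulo \<open>P\<close>. So \<open>q\<close> divides that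
  order for every \<open>P\<close> that divides \<open>g\<close> but none of finitely many exceptional primes, and
  the part of the norm \<open>N g\<close> prime to a fixed integer \<open>Z\<close> is \<open>1\<close> modulo \<open>q\<close>.

  Now let \<open>q\<close> be large, inert, and \<open>-1\<close> modulo a period of the powers of \<open>\<alpha>\<close> modulo \<open>W\<close>, a multiple of
  \<open>Z\<close>. Then \<open>\<alpha> ^ (q + 1)\<close> is idempotent modulo \<open>W\<close>, so the remaining factor \<open>D = gcd (N g) W\<close> of \<open>N g\<close> is
  bounded independently of \<open>q\<close> and divisible by \<open>N (1 - \<alpha> * \<beta>)\<close>. On the other hand
  \<open>N g\<close> is congruent to \<open>N (cnj \<alpha> - \<beta>)\<close> modulo \<open>q\<close> by the Frobenius. Hence \<open>D = N (cnj \<alpha> - \<beta>)\<close>,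
  contradicting \<open>N (1 - \<alpha> * \<beta>) - N (cnj \<alpha> - \<beta>) = (N \<alpha> - 1) * (N \<beta> - 1) > 0\<close>.

  Such \<open>q\<close> exist by an argument in the style of Euclid: a prime dividing the value at \<open>(u, cnj u)\<close> of the
  homogenised \<open>M\<close>-th cyclotomic polynomial, with \<open>u = s + t * sqrt (- m)\<close>, is \<open>1\<close> modulo \<open>M\<close> if it splits and
  \<open>-1\<close> if it is inert. Since that form takes negative values, it takes values whose
  absolute value is \<open>-1\<close> modulo \<open>M\<close> up to a constant factor, and these have an inert prime factor.
\<close>

section \<open>Subrings of a commutative ring and their prime ideals\<close>

hide_const (open) Divisibility.prime

text \<open>Subrings are subsets of a type, so the arithmetic is that of the type. As the ambient
  ring is usually a field, divisibility in \<open>S\<close> is stated with an explicit cofactor in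
  \<open>S\<close>.\<close>

locale subring_set =
  fixes S :: "'a::comm_ring_1 set"
  assumes one_mem: "1 \<in> S"
    and diff_mem: "x \<in> S \<Longrightarrow> y \<in> S \<Longrightarrow> x - y \<in> S"
    and mult_mem: "x \<in> S \<Longrightarrow> y \<in> S \<Longrightarrow> x * y \<in> S"
begin

lemma zero_mem: "0 \<in> S"
  using diff_mem[OF one_mem one_mem] by simp

lemma uminus_mem: "x \<in> S \<Longrightarrow> - x \<in> S"
  using diff_mem[OF zero_mem, of x] by simp

lemma add_mem: "x \<in> S \<Longrightarrow> y \<in> S \<Longrightarrow> x + y \<in> S"
  using diff_mem[of x "- y"] uminus_mem by simp

lemma power_mem: "x \<in> S \<Longrightarrow> x ^ n \<in> S"
  by (induction n) (auto intro: one_mem mult_mem)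

lemma of_nat_mem: "of_nat n \<in> S"
  by (induction n) (auto intro: zero_mem one_mem add_mem)

lemma of_int_mem: "of_int k \<in> S"
  by (cases k) (auto intro: of_nat_mem uminus_mem simp del: of_nat_Suc)

lemma sum_mem: "(\<And>i. i \<in> A \<Longrightarrow> f i \<in> S) \<Longrightarrow> sum f A \<in> S"
  by (induction A rule: infinite_finite_induct) (auto intro: zero_mem add_mem)

lemmas mem_intros = zero_mem one_mem uminus_mem add_mem diff_mem mult_mem power_mem
  of_nat_mem of_int_mem sum_mem

text \<open>The inner binomial coefficients are multiples of \<open>p\<close>. The cofactor
  \<open>z\<close> is exhibited in \<open>S\<close>, since divisibility by \<open>p\<close> says
  nothing in a field of characteristic 0.\<close>

lemma freshman_dream:
  assumes "prime p" and x: "x \<in> S" and y: "y \<in> S"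
  shows "\<exists>z\<in>S. (x + y) ^ p = x ^ p + y ^ p + of_nat p * z"
proof -
  have p: "p > 0" using assms(1) by (simp add: prime_gt_0_nat)
  define z where "z = (\<Sum>k\<in>{0<..<p}. of_nat ((p choose k) div p) * x ^ k * y ^ (p - k))"
  have "(x + y) ^ p = (\<Sum>k\<le>p. of_nat (p choose k) * x ^ k * y ^ (p - k))"
    by (rule binomial_ring)
  also have "{..p} = insert 0 (insert p {0<..<p})" using p by auto
  also have "(\<Sum>k\<in>insert 0 (insert p {0<..<p}). of_nat (p choose k) * x ^ k * y ^ (p - k))
     = x ^ p + y ^ p + (\<Sum>k\<in>{0<..<p}. of_nat (p choose k) * x ^ k * y ^ (p - k))"
    using p by (subst sum.insert; simp)+
  also have "(\<Sum>k\<in>{0<..<p}. of_nat (p choose k) * x ^ k * y ^ (p - k)) = of_nat p * z"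
    unfolding z_def sum_distrib_left
  proof (rule sum.cong)
    fix k assume k: "k \<in> {0<..<p}"
    have "p dvd (p choose k)"
      using k assms(1) by (intro dvd_choose_prime) auto
    then have "(of_nat (p choose k) :: 'a) = of_nat p * of_nat ((p choose k) div p)"
      by (metis dvd_mult_div_cancel of_nat_mult)
    then show "(of_nat (p choose k) :: 'a) * x ^ k * y ^ (p - k) = of_nat p * (of_nat ((p choose k) div p) * x ^ k * y ^ (p - k))"
      by (simp add: mult.assoc)
  qed simp
  finally show ?thesis
    by (intro bexI[of _ z]) (auto simp: z_def intro!: mem_intros x y)
qed

end

section \<open>Ideals, congruences and prime ideals\<close>

locale ideal_set = subring_set S for S :: "'a::comm_ring_1 set" +
  fixes I :: "'a set"
  assumes ideal_subset: "I \<subseteq> S"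
    and ideal_zero: "0 \<in> I"
    and ideal_add: "x \<in> I \<Longrightarrow> y \<in> I \<Longrightarrow> x + y \<in> I"
    and ideal_mult: "x \<in> S \<Longrightarrow> y \<in> I \<Longrightarrow> x * y \<in> I"
begin

lemma ideal_mult': "x \<in> I \<Longrightarrow> y \<in> S \<Longrightarrow> x * y \<in> I"
  using ideal_mult[of y x] by (simp add: mult.commute)

lemma ideal_uminus: "x \<in> I \<Longrightarrow> - x \<in> I"
  using ideal_mult[of "-1" x] by (simp add: mem_intros)

lemma ideal_diff: "x \<in> I \<Longrightarrow> y \<in> I \<Longrightarrow> x - y \<in> I"
  using ideal_add[OF _ ideal_uminus] by simp

lemma ideal_sum: "(\<And>i. i \<in> A \<Longrightarrow> f i \<in> I) \<Longrightarrow> sum f A \<in> I"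
  by (induction A rule: infinite_finite_induct) (auto intro: ideal_zero ideal_add)

lemma cong_sym: "x - y \<in> I \<Longrightarrow> y - x \<in> I"
  using ideal_uminus[of "x - y"] by simp

lemma cong_trans: "x - y \<in> I \<Longrightarrow> y - z \<in> I \<Longrightarrow> x - z \<in> I"
  using ideal_add[of "x - y" "y - z"] by simp

lemma cong_mult:
  assumes "x - x' \<in> I" "y - y' \<in> I" "x' \<in> S" "y \<in> S"
  shows "x * y - x' * y' \<in> I"
proof -
  have "x * y - x' * y' = y * (x - x') + x' * (y - y')" by (simp add: algebra_simps)
  then show ?thesis using assms by (auto intro: ideal_add ideal_mult)
qed

lemma cong_power:
  assumes "x - x' \<in> I" "x \<in> S" "x' \<in> S"
  shows "x ^ n - x' ^ n \<in> I"
  using assms by (induction n) (auto intro!: cong_mult ideal_zero mem_intros)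

lemma cong_mem: "x - y \<in> I \<Longrightarrow> y \<in> I \<Longrightarrow> x \<in> I"
  using ideal_add[of "x - y" y] by simp

end

locale prime_ideal_set = ideal_set S I for S :: "'a::comm_ring_1 set" and I +
  assumes proper: "1 \<notin> I"
    and prime_ideal: "x \<in> S \<Longrightarrow> y \<in> S \<Longrightarrow> x * y \<in> I \<Longrightarrow> x \<in> I \<or> y \<in> I"
begin

lemma prime_ideal_power: "x \<in> S \<Longrightarrow> x ^ n \<in> I \<Longrightarrow> x \<in> I"
proof (induction n)
  case (Suc n)
  then show ?case using prime_ideal[of x "x ^ n"] by (auto intro: mem_intros)
qed (use proper in auto)

text \<open>By Bezout, an integer in \<open>I\<close> that is prime to \<open>p\<close> would put
  \<open>1\<close> into \<open>I\<close>.\<close>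

lemma of_int_mem_iff:
  assumes "prime p" "of_nat p \<in> I"
  shows "of_int k \<in> I \<longleftrightarrow> int p dvd k"
proof
  assume "int p dvd k"
  then obtain l where "k = int p * l" ..
  then show "of_int k \<in> I" using ideal_mult'[OF assms(2) of_int_mem[of l]] by simp
next
  assume k: "of_int k \<in> I"
  show "int p dvd k"
  proof (rule ccontr)
    assume "\<not> int p dvd k"
    then have "coprime (int p) k" using assms(1) by (simp add: prime_imp_coprime)
    then obtain u v where "u * int p + v * k = 1"
      by (metis coprime_iff_gcd_eq_1 bezout_int)
    then have "of_int (u * int p + v * k) = (1::'a)" by simp
    then have "of_int u * of_nat p + of_int v * of_int k = (1::'a)" by simp
    moreover have "of_int u * of_nat p + of_int v * of_int k \<in> I"
      using assms(2) k by (intro ideal_add ideal_mult of_int_mem) auto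
    ultimately show False using proper by simp
  qed
qed

lemma of_nat_mem_iff:
  assumes "prime p" "of_nat p \<in> I"
  shows "of_nat k \<in> I \<longleftrightarrow> p dvd k"
  using of_int_mem_iff[OF assms, of "int k"] by simp

text \<open>Euclid's algorithm on the exponents; powers of \<open>u\<close> can be cancelled modulo
  the prime ideal.\<close>

lemma power_cong_gcd:
  assumes S: "u \<in> S" "v \<in> S" and v: "u \<notin> I" "v \<notin> I"
    and m: "u ^ m - v ^ m \<in> I" and n: "u ^ n - v ^ n \<in> I"
  shows "u ^ gcd m n - v ^ gcd m n \<in> I"
  using m n
proof (induction m n rule: gcd_nat_induct)
  case (step m n)
  have "u ^ (m mod n) - v ^ (m mod n) \<in> I"
  proof -
    let ?q = "n * (m div n)"
    have q: "u ^ ?q - v ^ ?q \<in> I"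
      unfolding power_mult using step.prems S by (auto intro!: cong_power[of "u ^ n"] mem_intros)
    have "u ^ ?q * (u ^ (m mod n) - v ^ (m mod n)) = 
       (u ^ m - v ^ m) - (u ^ ?q - v ^ ?q) * v ^ (m mod n)"
      by (simp add: algebra_simps flip: power_add)
    also have "\<dots> \<in> I"
      using step.prems q S by (intro ideal_diff[OF _ ideal_mult']) (auto intro: mem_intros)
    finally show ?thesis
      using prime_ideal[of "u ^ ?q" "u ^ (m mod n) - v ^ (m mod n)"] prime_ideal_power[of u ?q] S v
      by (auto intro: mem_intros)
  qed
  then show ?case using step by (metis gcd.commute gcd_red_nat)
qed auto

end

lemma (in subring_set) principal_ideal_set:
  assumes "t \<in> S"
  shows "ideal_set S {t * z | z. z \<in> S}"
proof unfold_locales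
  show "{t * z | z. z \<in> S} \<subseteq> S" using assms by (auto intro: mem_intros)
  show "0 \<in> {t * z | z. z \<in> S}" by (auto intro!: exI[of _ 0] zero_mem)
  show "x + y \<in> {t * z | z. z \<in> S}" if "x \<in> {t * z | z. z \<in> S}" "y \<in> {t * z | z. z \<in> S}" for x y
    using that by (auto simp flip: distrib_left intro: add_mem)
  show "x * y \<in> {t * z | z. z \<in> S}" if "x \<in> S" "y \<in> {t * z | z. z \<in> S}" for x y
    using that by (auto simp: mult.left_commute[of x] intro: mult_mem)
qed

lemma (in ideal_set) ideal_extend:
  assumes x: "x \<in> S"
  shows "ideal_set S {a + x * r | a r. a \<in> I \<and> r \<in> S}"
proof unfold_locales
  let ?J = "{a + x * r | a r. a \<in> I \<and> r \<in> S}"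
  show "?J \<subseteq> S" using ideal_subset x by (auto intro: mem_intros)
  show "0 \<in> ?J" by (rule CollectI, rule exI[of _ 0], rule exI[of _ 0]) (auto intro: mem_intros ideal_zero)
  show "y + z \<in> ?J" if "y \<in> ?J" "z \<in> ?J" for y z
  proof -
    from that obtain a r b s where *: "y = a + x * r" "z = b + x * s" "a \<in> I" "b \<in> I" "r \<in> S" "s \<in> S"
      by blast
    show ?thesis by (rule CollectI, rule exI[of _ "a + b"], rule exI[of _ "r + s"])
        (use * in \<open>auto simp: algebra_simps intro: mem_intros ideal_add\<close>)
  qed
  show "y * z \<in> ?J" if y: "y \<in> S" and "z \<in> ?J" for y z
  proof -
    from that obtain a r where *: "z = a + x * r" "a \<in> I" "r \<in> S" by blast
    have "y * z = y * a + x * (y * r)" using *(1) by (simp add: algebra_simps)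
    then show ?thesis using ideal_mult[OF y *(2)] mult_mem[OF y *(3)] by blast
  qed
qed

text \<open>Zorn's lemma yields an ideal maximal among those that contain \<open>I\<close> but not
  \<open>1\<close>, and such an ideal is prime.\<close>

lemma (in ideal_set) ex_prime_ideal:
  assumes "1 \<notin> I"
  obtains P where "prime_ideal_set S P" "I \<subseteq> P"
proof -
  let ?A = "{J. ideal_set S J \<and> I \<subseteq> J \<and> 1 \<notin> J}"
  have "\<exists>P\<in>?A. \<forall>J\<in>?A. P \<subseteq> J \<longrightarrow> J = P"
  proof (rule subset_Zorn_nonempty)
    show "?A \<noteq> {}" using assms ideal_set_axioms by auto
    fix C assume C: "C \<noteq> {}" "subset.chain ?A C"
    have C1: "J \<in> C \<Longrightarrow> ideal_set S J \<and> I \<subseteq> J \<and> 1 \<notin> J" for J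
      using C(2) by (auto simp: subset.chain_def)
    have C2: "J \<in> C \<Longrightarrow> L \<in> C \<Longrightarrow> J \<subseteq> L \<or> L \<subseteq> J" for J L
      using C(2) by (auto simp: subset.chain_def)
    have "ideal_set S (\<Union>C)"
    proof unfold_locales
      show "\<Union>C \<subseteq> S" using C1 ideal_set.ideal_subset by blast
      show "0 \<in> \<Union>C" using C1 C(1) ideal_set.ideal_zero by blast
      show "x * y \<in> \<Union>C" if "x \<in> S" "y \<in> \<Union>C" for x y
        using that C1 ideal_set.ideal_mult by blast
      show "x + y \<in> \<Union>C" if xy: "x \<in> \<Union>C" "y \<in> \<Union>C" for x y
      proof -
        from xy obtain J L where J: "J \<in> C" "x \<in> J" and L: "L \<in> C" "y \<in> L" by blast
        have "J \<subseteq> L \<or> L \<subseteq> J" by (rule C2[OF J(1) L(1)])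
        then show ?thesis
          using ideal_set.ideal_add[of S J x y] ideal_set.ideal_add[of S L x y] C1[OF J(1)] C1[OF L(1)] J L
          by blast
      qed
    qed
    then show "\<Union>C \<in> ?A" using C1 C(1) by auto
  qed
  then obtain P where P: "ideal_set S P" "I \<subseteq> P" "1 \<notin> P"
    and max: "\<And>J. ideal_set S J \<Longrightarrow> I \<subseteq> J \<Longrightarrow> 1 \<notin> J \<Longrightarrow> P \<subseteq> J \<Longrightarrow> J = P"
    by auto
  interpret P: ideal_set S P by fact
  \<comment> \<open>Otherwise the ideal generated by \<open>P\<close> and \<open>x\<close> would be
    larger and still omit \<open>1\<close>.\<close>
  have unit: "\<exists>a\<in>P. \<exists>r\<in>S. 1 = a + x * r" if x: "x \<in> S" "x \<notin> P" for x
  proof (rule ccontr)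
    assume no: "\<not> ?thesis"
    let ?J = "{a + x * r | a r. a \<in> P \<and> r \<in> S}"
    have "P \<subseteq> ?J"
    proof
      fix a assume "a \<in> P"
      then show "a \<in> ?J" by (intro CollectI exI[of _ a] exI[of _ 0]) (auto intro: mem_intros)
    qed
    moreover have "x \<in> ?J"
      by (intro CollectI exI[of _ 0] exI[of _ 1]) (auto intro: mem_intros P.ideal_zero)
    moreover have "1 \<notin> ?J" using no by blast
    ultimately show False using max[OF P.ideal_extend[OF x(1)]] P(2) x(2) by blast
  qed
  have "prime_ideal_set S P"
  proof unfold_locales
    show "1 \<notin> P" by fact
    fix x y assume xy: "x \<in> S" "y \<in> S" "x * y \<in> P"
    show "x \<in> P \<or> y \<in> P"
    proof (rule ccontr)
      assume "\<not> ?thesis"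
      then obtain a r where ar: "a \<in> P" "r \<in> S" "1 = a + x * r" "y \<notin> P" using unit[of x] xy by blast
      have "y = y * (a + x * r)" by (simp flip: ar(3))
      also have "\<dots> = y * a + r * (x * y)" by (simp add: algebra_simps)
      also have "\<dots> \<in> P" using ar xy by (intro P.ideal_add[OF P.ideal_mult P.ideal_mult]) auto
      finally show False using ar(4) by simp
    qed
  qed
  then show ?thesis using that P(2) by blast
qed

section \<open>The Frobenius on quadratic orders\<close>

text \<open>By \<open>freshman_dream\<close>, \<open>a ^ p - a\<close> is unchanged modulo
  \<open>p\<close> when \<open>a\<close> grows by \<open>1\<close>, so induction from
  \<open>0\<close> in both directions applies.\<close>

lemma fermat_little_int:
  assumes "prime p" "odd p"
  shows "int p dvd a ^ p - a"
proof -
  interpret subring_set "UNIV :: int set" by unfold_locales auto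
  have step: "int p dvd (k + 1) ^ p - (k + 1) \<longleftrightarrow> int p dvd k ^ p - k" for k
  proof -
    obtain z where z: "(k + 1) ^ p = k ^ p + 1 ^ p + int p * z"
      using freshman_dream[OF assms(1), of k 1] by auto
    have "(k + 1) ^ p - (k + 1) = (k ^ p - k) + int p * z" unfolding z by simp
    then show ?thesis by (metis dvd_add_left_iff dvd_triv_left)
  qed
  show ?thesis
  proof (induction a rule: int_induct[of _ 0])
    case base
    show ?case using prime_gt_0_nat[OF assms(1)] by (simp add: zero_power)
  next
    case (step1 i)
    then show ?case using step[of i] by simp
  next
    case (step2 i)
    then show ?case using step[of "i - 1"] by simp
  qed
qed

lemma fermat_int_minus_one:
  assumes "prime p" "odd p" "\<not> int p dvd a"
  shows "int p dvd a ^ (p - 1) - 1"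
proof -
  have "a ^ p - a = a * (a ^ (p - 1) - 1)"
    using prime_gt_0_nat[OF assms(1)] by (simp add: algebra_simps flip: power_Suc)
  then show ?thesis
    using fermat_little_int[OF assms(1,2), of a] assms by (simp add: prime_dvd_mult_iff)
qed

lemma euler_dichotomy:
  assumes "prime p" "odd p" "\<not> int p dvd a"
  shows "int p dvd a ^ ((p - 1) div 2) - 1 \<or> int p dvd a ^ ((p - 1) div 2) + 1"
proof -
  have "(p - 1) div 2 * 2 = p - 1" using assms by auto
  then have "a ^ (p - 1) = (a ^ ((p - 1) div 2))\<^sup>2" by (simp flip: power_mult)
  then have "a ^ (p - 1) - 1 = (a ^ ((p - 1) div 2) - 1) * (a ^ ((p - 1) div 2) + 1)"
    by (simp add: power2_eq_square algebra_simps)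
  then show ?thesis
    using fermat_int_minus_one[OF assms] assms(1) by (simp add: prime_dvd_mult_iff)
qed

text \<open>By Euler's criterion, \<open>nonres\<close> says that \<open>- m\<close> is a quadratic nonresidue modulo \<open>p\<close>.\<close>

lemma even_multiplicity_norm_form:
  assumes p: "prime p" "odd p" and nonres: "int p dvd (- int m) ^ ((p - 1) div 2) + 1"
    and "a\<^sup>2 + int m * b\<^sup>2 \<noteq> 0"
  shows "even (multiplicity (int p) (a\<^sup>2 + int m * b\<^sup>2))"
  using assms(4)
proof (induction "nat \<bar>a\<bar> + nat \<bar>b\<bar>" arbitrary: a b rule: less_induct)
  case less
  have prime: "prime (int p)" using p by simp
  show ?case
  proof (cases "int p dvd a\<^sup>2 + int m * b\<^sup>2")
    case False
    then show ?thesis by (simp add: not_dvd_imp_multiplicity_0)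
  next
    case True
    \<comment> \<open>If \<open>p\<close> did not divide \<open>b\<close>, then \<open>- m\<close>
      would be a square modulo \<open>p\<close>, against \<open>nonres\<close>.\<close>
    have b: "int p dvd b"
    proof (rule ccontr)
      assume nb: "\<not> int p dvd b"
      let ?h = "(p - 1) div 2"
      have h: "2 * ?h = p - 1" using p by auto
      have "(a\<^sup>2) ^ ?h - (- int m * b\<^sup>2) ^ ?h = (a\<^sup>2 - (- int m * b\<^sup>2)) *
          (\<Sum>i<?h. (- int m * b\<^sup>2) ^ (?h - Suc i) * (a\<^sup>2) ^ i)"
        by (rule power_diff_sumr2)
      then have "int p dvd (a\<^sup>2) ^ ?h - (- int m * b\<^sup>2) ^ ?h"
        using True by simp
      then have A: "int p dvd a ^ (p - 1) - (- int m) ^ ?h * b ^ (p - 1)"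
        by (simp only: power_mult_distrib h flip: power_mult)
      have B: "int p dvd b ^ (p - 1) - 1" using fermat_int_minus_one p nb by blast
      have C: "\<not> int p dvd - int m"
      proof
        assume "int p dvd - int m"
        moreover have "?h > 0" using p prime_ge_2_nat[of p] by (cases "p = 2") auto
        ultimately have "int p dvd (- int m) ^ ?h" using dvd_power dvd_trans by blast
        then have "int p dvd 1" using nonres by (metis dvd_add_right_iff)
        then show False using prime not_prime_unit by blast
      qed
      have na: "\<not> int p dvd a"
      proof
        assume "int p dvd a"
        then have "int p dvd int m * b\<^sup>2" using True
          by (metis dvd_add_right_iff dvd_mult2 power2_eq_square)
        then show False using C nb prime by (simp add: prime_dvd_mult_iff prime_dvd_power_iff)
      qed
      have D: "int p dvd a ^ (p - 1) - 1" using fermat_int_minus_one p na by blast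
      \<comment> \<open>Modulo \<open>p\<close>, \<open>a ^ (p - 1)\<close> and
        \<open>b ^ (p - 1)\<close> are \<open>1\<close> while the power of \<open>- m\<close> is
        \<open>-1\<close>, so \<open>p\<close> would divide \<open>2\<close>.\<close>
      have "2 = (a ^ (p - 1) - (- int m) ^ ?h * b ^ (p - 1)) - (a ^ (p - 1) - 1)
         + ((- int m) ^ ?h + 1) * b ^ (p - 1) - (b ^ (p - 1) - 1)"
        by (simp add: algebra_simps)
      also have "int p dvd \<dots>" by (rule dvd_diff[OF dvd_add[OF dvd_diff[OF A D] dvd_mult2[OF nonres]] B])
      finally have "int p dvd int 2" by simp
      then have "p dvd 2" by (simp only: int_dvd_int_iff)
      then show False using p using primes_dvd_imp_eq[of p 2] by simp
    qed
    have a: "int p dvd a"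
    proof -
      have "int p dvd a\<^sup>2" using True b
        by (metis dvd_add_left_iff dvd_mult dvd_mult2 power2_eq_square)
      then show ?thesis using prime prime_dvd_power by blast
    qed
    \<comment> \<open>Descent: dividing both coordinates by \<open>p\<close> removes the square of
      \<open>p\<close> from the value and keeps the parity of the multiplicity.\<close>
    obtain a' b' where ab: "a = int p * a'" "b = int p * b'" using a b by (auto elim!: dvdE)
    have eq: "a\<^sup>2 + int m * b\<^sup>2 = (int p)\<^sup>2 * (a'\<^sup>2 + int m * b'\<^sup>2)"
      by (simp add: ab power2_eq_square algebra_simps)
    have nz: "a'\<^sup>2 + int m * b'\<^sup>2 \<noteq> 0" using less.prems eq by auto
    have p1: "int p > 1" using prime prime_gt_1_int by blast
    have le: "nat \<bar>x\<bar> \<le> nat \<bar>int p * x\<bar> \<and> (x \<noteq> 0 \<longrightarrow> nat \<bar>x\<bar> < nat \<bar>int p * x\<bar>)" for x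
    proof -
      have "\<bar>x\<bar> \<le> int p * \<bar>x\<bar>" using p1 by (simp add: mult_le_cancel_right1)
      moreover have "x \<noteq> 0 \<Longrightarrow> \<bar>x\<bar> < int p * \<bar>x\<bar>" using p1 by simp
      ultimately show ?thesis by (auto simp: abs_mult)
    qed
    have "a' \<noteq> 0 \<or> b' \<noteq> 0" using nz by auto
    then have "nat \<bar>a'\<bar> + nat \<bar>b'\<bar> < nat \<bar>a\<bar> + nat \<bar>b\<bar>"
      unfolding ab using le[of a'] le[of b'] by linarith
    from less.hyps[OF this nz] have "even (multiplicity (int p) (a'\<^sup>2 + int m * b'\<^sup>2))" .
    then show ?thesis unfolding eq
      using nz prime p1 by (subst prime_elem_multiplicity_mult_distrib) (auto simp: multiplicity_same_power)
  qed
qed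

text \<open>The order generated by a square root \<open>t\<close> of an integer; it need not be the
  full ring of integers.\<close>

definition quadratic_order :: "'a::comm_ring_1 \<Rightarrow> 'a set" where
  "quadratic_order t = {of_int a + of_int b * t | a b. True}"

lemma subring_quadratic_order:
  assumes "t * t = of_int d"
  shows "subring_set (quadratic_order t)"
proof
  show "1 \<in> quadratic_order t"
    unfolding quadratic_order_def by (intro CollectI exI[of _ 1] exI[of _ 0]) simp
  fix x y assume "x \<in> quadratic_order t" "y \<in> quadratic_order t"
  then obtain a b a' b' where *: "x = of_int a + of_int b * t" "y = of_int a' + of_int b' * t"
    unfolding quadratic_order_def by blast
  show "x - y \<in> quadratic_order t" unfolding quadratic_order_def
    by (intro CollectI exI[of _ "a - a'"] exI[of _ "b - b'"]) (simp add: * algebra_simps)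
  have "x * y = of_int (a * a') + of_int (a * b' + b * a') * t + of_int (b * b') * (t * t)"
    by (simp add: * algebra_simps)
  then show "x * y \<in> quadratic_order t" unfolding quadratic_order_def assms
    by (intro CollectI exI[of _ "a * a' + b * b' * d"] exI[of _ "a * b' + b * a'"]) (simp add: algebra_simps)
qed

text \<open>By \<open>freshman_dream\<close> and Fermat only \<open>t ^ p\<close> matters, and it
  equals \<open>d ^ ((p - 1) div 2) * t\<close>. If \<open>p\<close> does not divide
  \<open>d\<close>, the \<open>p\<close>-th power is thus the identity or the conjugation modulo
  \<open>p\<close>.\<close>

lemma frobenius_quadratic_order:
  assumes t: "t * t = of_int d" and p: "prime p" "odd p"
  shows "\<exists>z\<in>quadratic_order t. (of_int a + of_int b * t) ^ p
     = of_int a + of_int (b * d ^ ((p - 1) div 2)) * t + of_nat p * z"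
proof -
  interpret subring_set "quadratic_order t" by (rule subring_quadratic_order[OF t])
  have tm: "t \<in> quadratic_order t"
    unfolding quadratic_order_def by (intro CollectI exI[of _ 0] exI[of _ 1]) simp
  let ?h = "(p - 1) div 2"
  obtain z where z: "z \<in> quadratic_order t"
      "(of_int a + of_int b * t) ^ p = of_int a ^ p + (of_int b * t) ^ p + of_nat p * z"
    using freshman_dream[OF p(1), of "of_int a" "of_int b * t"] tm by (auto intro: mem_intros)
  obtain k l where k: "a ^ p = a + int p * k" and l: "b ^ p = b + int p * l"
    using fermat_little_int[OF p, of a] fermat_little_int[OF p, of b]
    by (metis dvd_def diff_add_cancel add.commute)
  have "p = Suc (2 * ?h)" using p by (simp add: odd_pos)
  then have tp: "t ^ p = of_int (d ^ ?h) * t"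
    by (metis t power_Suc2 power_mult power2_eq_square of_int_power)
  have "(of_int a + of_int b * t) ^ p = of_int (a ^ p) + of_int (b ^ p) * t ^ p + of_nat p * z"
    unfolding z by (simp add: power_mult_distrib)
  also have "\<dots> = of_int a + of_int (b * d ^ ?h) * t
     + of_nat p * (of_int k + of_int (l * d ^ ?h) * t + z)"
    unfolding k l tp by (simp add: algebra_simps)
  finally show ?thesis
    by (intro bexI[of _ "of_int k + of_int (l * d ^ ?h) * t + z"]) (auto intro!: mem_intros z(1) tm)
qed

section \<open>Primes that are inert and congruent to -1\<close>

text \<open>The homogenisation of \<open>f\<close> in degree \<open>n\<close>. Being free of
  division, it can be evaluated in a subring and reduced modulo an ideal.\<close>

definition hom_eval :: "int poly \<Rightarrow> nat \<Rightarrow> 'a::comm_ring_1 \<Rightarrow> 'a \<Rightarrow> 'a" where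
  "hom_eval f n u v = (\<Sum>i\<le>n. of_int (poly.coeff f i) * u ^ i * v ^ (n - i))"

lemma map_poly_of_int_mult:
  "map_poly of_int (f * g) = (map_poly of_int f * map_poly of_int g :: 'a::comm_ring_1 poly)"
  by (rule poly_eqI) (simp add: coeff_map_poly coeff_mult)

lemma hom_eval_eq_poly:
  fixes u v :: "'a::field_char_0"
  assumes "v \<noteq> 0" "Polynomial.degree f \<le> n"
  shows "hom_eval f n u v = v ^ n * poly (map_poly of_int f) (u / v)"
proof -
  have "Polynomial.degree (map_poly of_int f :: 'a poly) \<le> n"
    using assms(2) by (intro degree_le) (auto simp: coeff_map_poly coeff_eq_0)
  then have "poly (map_poly of_int f) (u / v) = (\<Sum>i\<le>n. of_int (poly.coeff f i) * (u / v) ^ i)"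
    unfolding poly_altdef
    by (intro sum.mono_neutral_cong_left)
      (auto simp: coeff_map_poly not_le dest!: coeff_eq_0[where p = "map_poly of_int f :: 'a poly"])
  then show ?thesis
    unfolding hom_eval_def using assms(1)
    by (auto simp: sum_distrib_left power_divide power_diff intro!: sum.cong)
qed

lemma hom_eval_mult:
  fixes u v :: "'a::field_char_0"
  assumes "v \<noteq> 0"
  shows "hom_eval f (Polynomial.degree f) u v * hom_eval g (Polynomial.degree g) u v
    = v ^ (Polynomial.degree f + Polynomial.degree g) * poly (map_poly of_int (f * g)) (u / v)"
  by (simp add: assms hom_eval_eq_poly map_poly_of_int_mult power_add)

lemma degree_monom_minus_one: "n > 0 \<Longrightarrow> Polynomial.degree (Polynomial.monom (1::int) n - 1) = n"
  by (subst diff_conv_add_uminus, subst degree_add_eq_left) (auto simp: degree_monom_eq)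

lemma geometric_monom:
  "(\<Sum>j<n. Polynomial.monom 1 (g * j)) * (Polynomial.monom 1 g - 1) = (Polynomial.monom 1 (g * n) - 1 :: int poly)"
  by (induction n) (simp_all add: algebra_simps mult_monom)

text \<open>Modulo \<open>I\<close>, the quotient \<open>u / v\<close> is a root of unity of exact order \<open>M\<close>.\<close>

lemma dvd_of_hom_eval_mem:
  fixes u v :: "'a::field_char_0"
  assumes "prime_ideal_set S I"
    and M: "M > 0" "of_nat M \<notin> I" and f: "f dvd Polynomial.monom 1 M - 1"
    and primitive: "\<And>g. g dvd M \<Longrightarrow> g < M \<Longrightarrow> f dvd (\<Sum>j<M div g. Polynomial.monom 1 (g * j))"
    and S: "u \<in> S" "v \<in> S" and uv: "u \<notin> I" "v \<notin> I"
    and root: "hom_eval f (Polynomial.degree f) u v \<in> I"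
    and e: "u ^ e - v ^ e \<in> I"
  shows "M dvd e"
proof -
  interpret prime_ideal_set S I by fact
  have hS: "hom_eval h n u v \<in> S" for h n
    unfolding hom_eval_def using S by (intro mem_intros)
  have v0: "v \<noteq> 0" using uv ideal_zero by auto
  let ?X = "\<lambda>n. Polynomial.monom (1::int) n - 1"
  have evX: "poly (map_poly of_int (?X n)) (u / v) = (u / v) ^ n - 1" for n
  proof -
    have "map_poly of_int (?X n) = (Polynomial.monom 1 n - 1 :: 'a poly)"
      by (rule poly_eqI) (simp add: coeff_map_poly)
    then show ?thesis by (simp add: poly_monom)
  qed
  \<comment> \<open>The value of the form of \<open>f\<close> divides that of the form of
    \<open>X ^ M - 1\<close>, which is \<open>u ^ M - v ^ M\<close>.\<close>
  have M_root: "u ^ M - v ^ M \<in> I"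
  proof -
    obtain h where h: "?X M = f * h" using f by (elim dvdE)
    then have "f \<noteq> 0" "h \<noteq> 0" using degree_monom_minus_one[OF M(1)] M by auto
    then have deg: "Polynomial.degree f + Polynomial.degree h = M"
      using degree_monom_minus_one[OF M(1)] h by (simp add: degree_mult_eq)
    have "hom_eval f (Polynomial.degree f) u v * hom_eval h (Polynomial.degree h) u v
       = v ^ M * ((u / v) ^ M - 1)"
      using hom_eval_mult[OF v0, where f = f and g = h and u = u] deg evX[of M] h by simp
    also have "\<dots> = u ^ M - v ^ M" using v0 by (simp add: field_simps)
    finally show ?thesis using ideal_mult'[OF root hS] by metis
  qed
  let ?g = "gcd M e"
  have g_root: "u ^ ?g - v ^ ?g \<in> I" by (rule power_cong_gcd[OF S uv M_root e])
  \<comment> \<open>For a proper divisor \<open>?g\<close> of \<open>M\<close>, \<open>f\<close>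
    divides a geometric sum of \<open>n = M div ?g\<close> terms. Modulo \<open>I\<close> these
    terms are all equal, as \<open>u ^ ?g\<close> is \<open>v ^ ?g\<close>, so \<open>n\<close>, and
    with it \<open>M\<close>, would lie in \<open>I\<close>.\<close>
  show ?thesis
  proof (rule ccontr)
    assume "\<not> M dvd e"
    then have "?g \<noteq> M" by (metis gcd_dvd2)
    moreover have "?g \<le> M" using M(1) by (simp add: gcd_le1_nat)
    ultimately have "?g < M" by (rule le_neq_implies_less[rotated])
    with M have g: "?g < M" "?g dvd M" "?g > 0" by auto
    define n where "n = M div ?g"
    have n: "?g * n = M" using g by (simp add: n_def)
    have n0: "n > 0" using n M(1) by (cases "n = 0") auto
    obtain h where h: "(\<Sum>j<n. Polynomial.monom 1 (?g * j)) = f * h"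
      using primitive[OF g(2,1)] unfolding n_def by (elim dvdE)
    have X: "f * h * ?X ?g = ?X M" using geometric_monom[of ?g n] h n by simp
    have "f \<noteq> 0" "h \<noteq> 0" "?X ?g \<noteq> 0" using degree_monom_minus_one[OF M(1)] M X by auto
    then have "Polynomial.degree f + Polynomial.degree h + ?g = M"
      using degree_monom_minus_one[OF M(1)] degree_monom_minus_one[OF g(3)] arg_cong[OF X, of Polynomial.degree]
      by (simp add: degree_mult_eq)
    then have deg: "Polynomial.degree f + Polynomial.degree h = ?g * (n - 1)"
      using n0 n by (simp add: right_diff_distrib')
    have evS: "map_poly of_int (\<Sum>j<n. Polynomial.monom (1::int) (?g * j)) =
       ((\<Sum>j<n. Polynomial.monom 1 (?g * j)) :: 'a poly)"
      by (rule poly_eqI) (simp add: coeff_map_poly Polynomial.coeff_sum, intro sum.cong, auto)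
    have "hom_eval f (Polynomial.degree f) u v * hom_eval h (Polynomial.degree h) u v
       = v ^ (?g * (n - 1)) * (\<Sum>j<n. (u / v) ^ (?g * j))"
      using hom_eval_mult[OF v0, where f = f and g = h and u = u] deg h evS
      by (simp add: poly_sum poly_monom)
    also have "\<dots> = (\<Sum>j<n. (u ^ ?g) ^ j * (v ^ ?g) ^ (n - 1 - j))"
      unfolding sum_distrib_left
    proof (rule sum.cong)
      fix j assume "j \<in> {..<n}"
      then have "j + (n - 1 - j) = n - 1" by auto
      then have "?g * (n - 1) = ?g * j + ?g * (n - 1 - j)" by (simp flip: distrib_left)
      then have "v ^ (?g * (n - 1)) = v ^ (?g * j) * v ^ (?g * (n - 1 - j))"
        by (simp only: power_add)
      then show "v ^ (?g * (n - 1)) * (u / v) ^ (?g * j) = (u ^ ?g) ^ j * (v ^ ?g) ^ (n - 1 - j)"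
        using v0 by (simp add: power_divide power_mult)
    qed simp
    finally have sum_mem: "(\<Sum>j<n. (u ^ ?g) ^ j * (v ^ ?g) ^ (n - 1 - j)) \<in> I"
      using ideal_mult'[OF root hS] by metis
    have "(\<Sum>j<n. (u ^ ?g) ^ j * (v ^ ?g) ^ (n - 1 - j)) - (\<Sum>j<n. (v ^ ?g) ^ j * (v ^ ?g) ^ (n - 1 - j)) \<in> I"
      unfolding sum_subtractf[symmetric]
    proof (rule ideal_sum)
      fix j
      show "(u ^ ?g) ^ j * (v ^ ?g) ^ (n - 1 - j) - (v ^ ?g) ^ j * (v ^ ?g) ^ (n - 1 - j) \<in> I"
        unfolding left_diff_distrib[symmetric]
        using S by (intro ideal_mult'[OF cong_power[OF g_root]] mem_intros)
    qed
    then have "(\<Sum>j<n. (v ^ ?g) ^ j * (v ^ ?g) ^ (n - 1 - j)) \<in> I"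
      using sum_mem cong_mem cong_sym by blast
    also have "(\<Sum>j<n. (v ^ ?g) ^ j * (v ^ ?g) ^ (n - 1 - j)) = of_nat n * (v ^ ?g) ^ (n - 1)"
    proof -
      have "(\<Sum>j<n. (v ^ ?g) ^ j * (v ^ ?g) ^ (n - 1 - j)) = (\<Sum>j<n. (v ^ ?g) ^ (n - 1))"
        using n by (intro sum.cong) (auto simp flip: power_add)
      then show ?thesis by simp
    qed
    finally have "of_nat n * (v ^ ?g) ^ (n - 1) \<in> I" .
    moreover have "(v ^ ?g) ^ (n - 1) \<notin> I"
      using prime_ideal_power[of v "?g * (n - 1)"] S uv by (auto simp: power_mult)
    ultimately have "of_nat n \<in> I"
      using prime_ideal[of "of_nat n" "(v ^ ?g) ^ (n - 1)"] S by (simp add: mem_intros)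
    then have "of_nat ?g * of_nat n \<in> I" by (rule ideal_mult[OF of_nat_mem])
    then show False using n(1) M(2) by (simp only: of_nat_mult[symmetric])
  qed
qed

section \<open>The cyclotomic polynomial as a prime factor\<close>

lemma poly_map_of_int_complex_cnj:
  "poly (map_poly of_int f) (cnj z) = cnj (poly (map_poly of_int f) z)"
  by (rule poly_cnj_real[symmetric]) (simp add: coeff_map_poly)

lemma prime_factor_with_root:
  fixes z :: "'a::field_char_0"
  assumes "f \<noteq> 0" "poly (map_poly of_int f) z = 0"
  shows "\<exists>p :: int poly. prime p \<and> p dvd f \<and> poly (map_poly of_int p) z = 0"
  using assms
proof (induction f rule: prime_divisors_induct)
  case (unit f)
  then obtain g where "1 = f * g" by (elim dvdE)
  then have "map_poly of_int f * map_poly of_int g = (1 :: 'a poly)"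
    by (simp flip: map_poly_of_int_mult)
  then have "poly (map_poly of_int f * map_poly of_int g) z = 1"
    by simp
  then show ?case using unit by simp
next
  case (factor p f)
  then have "poly (map_poly of_int p) z = 0 \<or> poly (map_poly of_int f) z = 0" "f \<noteq> 0"
    by (auto simp: map_poly_of_int_mult)
  then show ?case using factor by (auto intro: dvd_mult)
qed simp

lemma poly_reflect_poly_1: "poly (reflect_poly f) (1 :: 'a::comm_ring_1) = poly f 1"
proof (induction f)
  case (pCons a f)
  then show ?case by (cases "f = 0") (simp_all add: reflect_poly_pCons' poly_monom)
qed simp

text \<open>The \<open>M\<close>-th cyclotomic polynomial, obtained as a prime factor of
  \<open>X ^ M - 1\<close> that vanishes at \<open>\<zeta>\<close>, with the sign fixed by
  \<open>poly f 1 > 0\<close>.\<close>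

lemma ex_primitive_palindromic_factor:
  assumes M: "M \<ge> 3"
  defines "\<zeta> \<equiv> cis (2 * pi / real M)"
  obtains f :: "int poly" where "f dvd Polynomial.monom 1 M - 1"
    and "\<And>g. g dvd M \<Longrightarrow> g < M \<Longrightarrow> f dvd (\<Sum>j<M div g. Polynomial.monom 1 (g * j))"
    and "reflect_poly f = f" and "poly f 1 > 0"
    and "poly (map_poly of_int f) \<zeta> = 0" and "poly (pderiv (map_poly of_int f)) \<zeta> \<noteq> 0"
proof -
  let ?X = "\<lambda>n. Polynomial.monom (1::int) n - 1"
  define E where "E f = poly (map_poly of_int f) \<zeta>" for f
  have E_mult: "E (f * g) = E f * E g" for f g by (simp add: E_def map_poly_of_int_mult)
  have E_dvd: "g dvd f \<Longrightarrow> E g = 0 \<Longrightarrow> E f = 0" for f g by (auto elim!: dvdE simp: E_mult)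
  have mapX: "map_poly of_int (?X n) = (Polynomial.monom 1 n - 1 :: complex poly)" for n
    by (rule poly_eqI) (simp add: coeff_map_poly)
  have EX: "E (?X n) = \<zeta> ^ n - 1" for n by (simp add: E_def mapX poly_monom)
  have zpow: "\<zeta> ^ n = cis (2 * pi * (real n / real M))" for n
    unfolding \<zeta>_def DeMoivre by (simp add: field_simps)
  have zM: "\<zeta> ^ M = 1" using M unfolding zpow by simp
  have z0: "\<zeta> \<noteq> 0" by (simp add: \<zeta>_def)
  have zn: "\<zeta> ^ n \<noteq> 1" if n: "0 < n" "n < M" for n
  proof
    assume "\<zeta> ^ n = 1"
    then have "cos (2 * pi * (real n / real M)) = 1" by (simp add: zpow complex_eq_iff)
    then obtain k :: int where k: "2 * pi * (real n / real M) = of_int k * 2 * pi"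
      by (auto simp: cos_one_2pi_int)
    then have "2 * pi * (real n / real M - of_int k) = 0" by (simp only: algebra_simps)
    then have "real n / real M = of_int k" by simp
    moreover have "0 < real n / real M" "real n / real M < 1" using n by auto
    ultimately show False by auto
  qed
  \<comment> \<open>The derivative of \<open>X ^ M - 1\<close> does not vanish at
    \<open>\<zeta>\<close>, so the root is simple and belongs to only one of two complementary
    factors.\<close>
  have simple: "E h \<noteq> 0" "poly (pderiv (map_poly of_int f)) \<zeta> \<noteq> 0" if fh: "f * h = ?X M" and f: "E f = 0" for f h
  proof -
    have "poly (pderiv (map_poly of_int (f * h))) \<zeta> = of_nat M * \<zeta> ^ (M - 1)"
      unfolding fh mapX using M by (simp add: pderiv_diff pderiv_monom poly_monom)
    then have "poly (pderiv (map_poly of_int f)) \<zeta> * E h = of_nat M * \<zeta> ^ (M - 1)"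
      using f by (simp add: map_poly_of_int_mult pderiv_mult E_def mult.commute)
    moreover have "of_nat M * \<zeta> ^ (M - 1) \<noteq> 0" using M z0 by simp
    ultimately show "E h \<noteq> 0" "poly (pderiv (map_poly of_int f)) \<zeta> \<noteq> 0" by auto
  qed
  have "?X M \<noteq> 0" using degree_monom_minus_one[of M] M by auto
  then obtain p where p: "prime p" "p dvd ?X M" "E p = 0"
    using prime_factor_with_root[of "?X M" \<zeta>] EX[of M] zM unfolding E_def by auto
  obtain h where h: "p * h = ?X M" using p(2) unfolding dvd_def by metis
  \<comment> \<open>\<open>X ^ M - 1\<close> is this sum times \<open>X ^ g - 1\<close>, and the
    latter does not vanish at \<open>\<zeta>\<close>, so the prime \<open>p\<close> divides the
    sum.\<close>
  have primitive: "p dvd (\<Sum>j<M div g. Polynomial.monom 1 (g * j))" if g: "g dvd M" "g < M" for g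
  proof -
    have "g > 0" using g M by (auto intro: Nat.gr0I)
    have "p dvd (\<Sum>j<M div g. Polynomial.monom 1 (g * j)) * ?X g"
      using p(2) g unfolding geometric_monom by simp
    moreover have "\<not> p dvd ?X g"
    proof
      assume "p dvd ?X g"
      then have "E (?X g) = 0" using p(3) by (rule E_dvd)
      then show False using EX zn[OF \<open>g > 0\<close> g(2)] by simp
    qed
    ultimately show ?thesis using p(1) prime_dvd_multD by blast
  qed
  \<comment> \<open>\<open>p\<close> divides \<open>1 + X + ... + X ^ (M - 1)\<close>, whose value
    at \<open>1\<close> is \<open>M\<close>.\<close>
  have p1: "poly p 1 \<noteq> 0"
  proof
    assume "poly p 1 = 0"
    moreover have "p dvd (\<Sum>j<M. Polynomial.monom 1 j)" using primitive[of 1] M by simp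
    ultimately have "poly (\<Sum>j<M. Polynomial.monom 1 j) (1::int) = 0"
      by (auto elim!: dvdE)
    then show False using M by (simp add: poly_sum poly_monom)
  qed
  have reflX: "reflect_poly (?X M) = - ?X M"
  proof (rule poly_eqI)
    fix n
    show "poly.coeff (reflect_poly (?X M)) n = poly.coeff (- ?X M) n"
      using M degree_monom_minus_one[of M] by (auto simp: coeff_reflect_poly coeff_1)
  qed
  \<comment> \<open>Reflection inverts roots, and the inverse of \<open>\<zeta>\<close> is its
    conjugate, again a root of the integer polynomial \<open>p\<close>.\<close>
  have Erefl: "E (reflect_poly p) = 0"
  proof -
    have "map_poly of_int (reflect_poly p) = (reflect_poly (map_poly of_int p) :: complex poly)"
    proof (rule poly_eqI)
      fix n
      have "Polynomial.degree (map_poly of_int p :: complex poly) = Polynomial.degree p"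
        using p1 by (intro map_poly_degree_eq) force
      then show "poly.coeff (map_poly of_int (reflect_poly p)) n = poly.coeff (reflect_poly (map_poly of_int p) :: complex poly) n"
        by (simp add: coeff_map_poly coeff_reflect_poly)
    qed
    then have "E (reflect_poly p) = \<zeta> ^ Polynomial.degree (map_poly of_int p :: complex poly) * poly (map_poly of_int p) (inverse \<zeta>)"
      unfolding E_def using z0 by (simp add: poly_reflect_poly_nz)
    also have "inverse \<zeta> = cnj \<zeta>" by (simp add: \<zeta>_def cis_cnj)
    finally show ?thesis using p(3) by (simp add: poly_map_of_int_complex_cnj E_def)
  qed
  have "reflect_poly p * (- reflect_poly h) = ?X M"
    using arg_cong[OF h, of reflect_poly] reflX by (simp add: reflect_poly_mult)
  note * = this
  \<comment> \<open>The cofactor of the reflected \<open>p\<close> in \<open>X ^ M - 1\<close> does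
    not vanish at \<open>\<zeta>\<close>, so \<open>p\<close> must divide the reflected
    \<open>p\<close> itself.\<close>
  have "\<not> p dvd - reflect_poly h" using simple(1)[OF * Erefl] p(3) E_dvd by blast
  moreover have "p dvd reflect_poly p * (- reflect_poly h)" unfolding * by (rule p(2))
  ultimately have "p dvd reflect_poly p" using p(1) prime_dvd_multD by blast
  then obtain c where c: "reflect_poly p = p * c" ..
  have pn0: "p \<noteq> 0" using p1 by force
  have refl0: "reflect_poly p \<noteq> 0" using pn0 by simp
  have "c \<noteq> 0" using c refl0 by auto
  then have "Polynomial.degree p + Polynomial.degree c \<le> Polynomial.degree p"
    using c pn0 degree_reflect_poly_le[of p] by (simp add: degree_mult_eq)
  then obtain c0 where c0: "c = [:c0:]" by (auto elim: degree_eq_zeroE)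
  \<comment> \<open>\<open>p\<close> and its reflection agree at \<open>1\<close>, where they are
    nonzero; this excludes the constant \<open>-1\<close>.\<close>
  have "c0 = 1" using p1 c c0 poly_reflect_poly_1[of p] by simp
  then have refl: "reflect_poly p = p" using c c0 by simp
  have der: "poly (pderiv (map_poly of_int p)) \<zeta> \<noteq> 0" by (rule simple(2)[OF h p(3)])
  show ?thesis
  proof (cases "poly p 1 > 0")
    case True
    then show ?thesis using that[of p] p primitive refl der unfolding E_def by blast
  next
    case False
    have "map_poly of_int (- p) = (- map_poly of_int p :: complex poly)"
      by (rule poly_eqI) (simp add: coeff_map_poly)
    then show ?thesis using that[of "- p"] p primitive refl der False p1
      unfolding E_def by (simp add: pderiv_minus reflect_poly_smult[of "-1" p, simplified])
  qed
qed

section \<open>The palindromic form: symmetry, congruences and sign\<close>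

text \<open>Palindromic coefficients make the form symmetric, so that its values at pairs of
  conjugates are real.\<close>

lemma hom_eval_swap:
  assumes "reflect_poly f = f"
  shows "hom_eval f (Polynomial.degree f) v u = hom_eval f (Polynomial.degree f) u v"
proof -
  let ?n = "Polynomial.degree f"
  have c: "poly.coeff f (?n - i) = poly.coeff f i" if "i \<le> ?n" for i
    using that arg_cong[OF assms, of "\<lambda>g. poly.coeff g i"] by (simp add: coeff_reflect_poly)
  show ?thesis unfolding hom_eval_def
    by (rule sum.reindex_bij_witness[of _ "\<lambda>i. ?n - i" "\<lambda>i. ?n - i"])
      (auto simp: c mult.assoc mult.left_commute mult.commute)
qed

lemma hom_eval_scale: "hom_eval f n (c * u) (c * v) = c ^ n * hom_eval f n u v"
  unfolding hom_eval_def sum_distrib_left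
proof (rule sum.cong)
  fix i assume "i \<in> {..n}"
  then have "c ^ n = c ^ i * c ^ (n - i)" by (simp flip: power_add)
  then show "of_int (poly.coeff f i) * (c * u) ^ i * (c * v) ^ (n - i) =
      c ^ n * (of_int (poly.coeff f i) * u ^ i * v ^ (n - i))"
    by (simp add: power_mult_distrib mult_ac)
qed simp

lemma cnj_hom_eval: "cnj (hom_eval f n u v) = hom_eval f n (cnj u) (cnj v)"
  by (simp add: hom_eval_def)

lemma hom_eval_diag: "hom_eval f (Polynomial.degree f) u u = of_int (poly f 1) * u ^ Polynomial.degree f"
proof -
  have "hom_eval f (Polynomial.degree f) u u = (\<Sum>i\<le>Polynomial.degree f. of_int (poly.coeff f i) * u ^ Polynomial.degree f)"
    unfolding hom_eval_def by (intro sum.cong) (auto simp: mult.assoc simp flip: power_add)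
  then show ?thesis by (simp add: poly_altdef sum_distrib_right)
qed

lemma hom_eval_zero_left: "hom_eval f n 0 v = of_int (poly.coeff f 0) * v ^ n"
proof -
  have "hom_eval f n 0 v = (\<Sum>i\<in>{0}. of_int (poly.coeff f i) * 0 ^ i * v ^ (n - i))"
    unfolding hom_eval_def by (rule sum.mono_neutral_right) (auto simp: power_0_left)
  then show ?thesis by simp
qed

lemma (in ideal_set) hom_eval_cong:
  assumes "u - u' \<in> I" "v - v' \<in> I" and S: "u \<in> S" "v \<in> S" "u' \<in> S" "v' \<in> S"
  shows "hom_eval f n u v - hom_eval f n u' v' \<in> I"
  unfolding hom_eval_def sum_subtractf[symmetric]
proof (rule ideal_sum)
  fix i
  show "of_int (poly.coeff f i) * u ^ i * v ^ (n - i) - of_int (poly.coeff f i) * u' ^ i * v' ^ (n - i) \<in> I"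
    unfolding mult.assoc right_diff_distrib[symmetric]
    by (intro ideal_mult of_int_mem cong_mult[OF cong_power cong_power] power_mem assms)
qed

text \<open>
  On the line \<open>u = 1 + \<i> x\<close> the form is real and vanishes to first order at \<open>x = tan (pi / M)\<close>,
  where \<open>u / cnj u\<close> is the primitive \<open>M\<close>-th root of unity.
\<close>

lemma hom_eval_negative_interval:
  assumes M: "M \<ge> 3"
  defines "\<zeta> \<equiv> cis (2 * pi / real M)"
  assumes refl: "reflect_poly f = f" and root: "poly (map_poly of_int f) \<zeta> = 0"
    and der: "poly (pderiv (map_poly of_int f)) \<zeta> \<noteq> 0"
  obtains a b :: real where "0 < a" "a < b"
    and "\<And>x. a < x \<Longrightarrow> x < b \<Longrightarrow>
      Re (hom_eval f (Polynomial.degree f) (1 + \<i> * of_real x) (1 - \<i> * of_real x)) < 0"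
proof -
  let ?n = "Polynomial.degree f"
  let ?P = "map_poly of_int f :: complex poly"
  define H where "H x = hom_eval f ?n (1 + \<i> * of_real x) (1 - \<i> * of_real x)" for x :: real
  \<comment> \<open>\<open>G\<close> extends \<open>H\<close> to complex arguments, so that
    \<open>H\<close> can be differentiated by the complex rules.\<close>
  define G where "G x = (1 - \<i> * x) ^ ?n * poly ?P ((1 + \<i> * x) / (1 - \<i> * x))" for x :: complex
  have nz: "1 - \<i> * of_real x \<noteq> 0" for x :: real
    by (auto simp: complex_eq_iff)
  have HG: "H x = G (of_real x)" for x
    unfolding H_def G_def by (rule hom_eval_eq_poly[OF nz]) simp
  have real: "Im (H x) = 0" for x
  proof -
    have "cnj (H x) = H x" unfolding H_def cnj_hom_eval
      by (subst hom_eval_swap[OF refl, symmetric]) simp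
    then show ?thesis by (simp add: complex_eq_iff)
  qed
  define \<tau> where "\<tau> = tan (pi / real M)"
  have ang: "0 < pi / real M" "pi / real M < pi / 2" using M by (auto simp: field_simps)
  then have cos: "cos (pi / real M) > 0" using cos_gt_zero by blast
  have \<tau>: "\<tau> > 0" unfolding \<tau>_def using ang tan_gt_zero by blast
  have w: "(1 + \<i> * of_real \<tau>) / (1 - \<i> * of_real \<tau>) = \<zeta>"
  proof -
    have 1: "1 + \<i> * of_real \<tau> = cis (pi / real M) / of_real (cos (pi / real M))"
      using cos by (simp add: complex_eq_iff \<tau>_def tan_def cis.code Re_divide_of_real Im_divide_of_real)
    have 2: "1 - \<i> * of_real \<tau> = cis (- pi / real M) / of_real (cos (pi / real M))"
      using cos by (simp add: complex_eq_iff \<tau>_def tan_def cis.code Re_divide_of_real Im_divide_of_real)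
    show ?thesis unfolding 1 2 \<zeta>_def using cos by (simp add: cis_divide)
  qed
  have H0: "H \<tau> = 0" unfolding HG G_def w using root by simp
  \<comment> \<open>Since the polynomial vanishes at \<open>\<zeta>\<close>, only the term that
    differentiates it contributes; its argument has derivative
    \<open>2 * \<i> / (1 - \<i> * x)\<^sup>2\<close>.\<close>
  define D where "D = (1 - \<i> * of_real \<tau>) ^ ?n * poly (pderiv ?P) \<zeta> * (2 * \<i> / (1 - \<i> * of_real \<tau>)\<^sup>2)"
  have "(G has_field_derivative D) (at (of_real \<tau>))"
    unfolding G_def
    by (rule derivative_eq_intros refl nz | simp add: w root)+
      (simp add: D_def w root nz field_simps power2_eq_square)
  then have "(G has_derivative (\<lambda>h. D * h)) (at (of_real \<tau>))"
    by (simp add: has_field_derivative_def)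
  moreover have "((of_real :: real \<Rightarrow> complex) has_derivative of_real) (at \<tau>)"
    by (rule bounded_linear.has_derivative[OF bounded_linear_of_real has_derivative_ident])
  ultimately have dH: "(H has_derivative (\<lambda>h. D * of_real h)) (at \<tau>)"
    unfolding HG[abs_def] by (rule has_derivative_compose[rotated])
  have dRe: "((\<lambda>x. Re (H x)) has_real_derivative Re D) (at \<tau>)"
    using bounded_linear.has_derivative[OF bounded_linear_Re dH]
    by (simp add: has_field_derivative_def)
  have "((\<lambda>x. Im (H x)) has_real_derivative Im D) (at \<tau>)"
    using bounded_linear.has_derivative[OF bounded_linear_Im dH]
    by (simp add: has_field_derivative_def)
  \<comment> \<open>\<open>H\<close> is real on the real line, so its nonzero derivative
    \<open>D\<close> is real, and \<open>H\<close> changes sign at \<open>\<tau>\<close>.\<close>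
  then have "Im D = 0" unfolding real using DERIV_unique DERIV_const by blast
  moreover have "D \<noteq> 0" unfolding D_def using der nz by simp
  ultimately have "Re D \<noteq> 0" by (simp add: complex_eq_iff)
  then consider "Re D < 0" | "Re D > 0" by linarith
  then show ?thesis
  proof cases
    case 1
    obtain d where d: "d > 0" "\<And>h. h > 0 \<Longrightarrow> h < d \<Longrightarrow> Re (H (\<tau> + h)) < Re (H \<tau>)"
      using DERIV_neg_dec_right[OF dRe 1] by blast
    show ?thesis
    proof (rule that)
      show "0 < \<tau>" "\<tau> < \<tau> + d" using \<tau> d by auto
      fix x assume "\<tau> < x" "x < \<tau> + d"
      then show "Re (hom_eval f ?n (1 + \<i> * of_real x) (1 - \<i> * of_real x)) < 0"
        using d(2)[of "x - \<tau>"] H0 by (simp add: H_def)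
    qed
  next
    case 2
    obtain d where d: "d > 0" "\<And>h. h > 0 \<Longrightarrow> h < d \<Longrightarrow> Re (H (\<tau> - h)) < Re (H \<tau>)"
      using DERIV_pos_inc_left[OF dRe 2] by blast
    show ?thesis
    proof (rule that)
      show "0 < max (\<tau> / 2) (\<tau> - d)" "max (\<tau> / 2) (\<tau> - d) < \<tau>" using \<tau> d by auto
      fix x assume "max (\<tau> / 2) (\<tau> - d) < x" "x < \<tau>"
      then show "Re (hom_eval f ?n (1 + \<i> * of_real x) (1 - \<i> * of_real x)) < 0"
        using d(2)[of "\<tau> - x"] H0 by (simp add: H_def)
    qed
  qed
qed

section \<open>Negative values of the form and their prime factors\<close>

text \<open>Used contrapositively, as in Euclid's argument: a number that is not \<open>1\<close>
  modulo \<open>m\<close> has a prime factor that is not.\<close>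

lemma nat_cong_1_of_prime_factors:
  fixes k m :: nat
  assumes "k > 0" "\<And>q. prime q \<Longrightarrow> q dvd k \<Longrightarrow> int m dvd int q - 1"
  shows "int m dvd int k - 1"
  using assms
proof (induction k rule: prime_divisors_induct)
  case (factor p k)
  have "int m dvd int p - 1" "int m dvd int k - 1" using factor by auto
  then have "int m dvd (int p - 1) * int k + (int k - 1)" by (intro dvd_add dvd_mult2)
  then show ?case by (simp add: algebra_simps)
qed auto

text \<open>For fixed \<open>t\<close> the admissible \<open>s\<close> fill an interval whose length
  is proportional to \<open>t\<close>; once it exceeds \<open>2 * N\<close> it contains a number
  that is \<open>1\<close> modulo \<open>N\<close>.\<close>

lemma negative_value_in_progression:
  fixes a b :: real and N p m n :: nat
  assumes ab: "0 < a" "a < b" and N: "N \<ge> 2" and m: "m > 0"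
  obtains s t j :: nat where "s > 0" "t = N ^ (j + 2)" "int N dvd int s - 1"
    and "a < real t * sqrt (real m) / real s" "real t * sqrt (real m) / real s < b"
proof -
  define c where "c = sqrt (real m) * (1 / a - 1 / b)"
  have c: "c > 0" unfolding c_def using ab m by (auto simp: field_simps)
  obtain j where j: "real N * 2 / c < 2 ^ j" using real_arch_pow[of 2] by auto
  define t where "t = N ^ (j + 2)"
  have t: "t > 0" using N by (simp add: t_def)
  have "(2::real) ^ j \<le> real N ^ j" using N by (intro power_mono) auto
  also have "\<dots> \<le> real t" unfolding t_def of_nat_power using N by (intro power_increasing) auto
  finally have "real N * 2 / c < real t" using j by linarith
  then have tc: "real N * 2 < real t * c" using c by (simp add: field_simps)
  define lo where "lo = real t * sqrt (real m) / b"
  define hi where "hi = real t * sqrt (real m) / a"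
  have "hi - lo = real t * c" by (simp add: hi_def lo_def c_def algebra_simps)
  then have gap: "hi - lo > 2 * real N" using tc by simp
  have lo: "lo > 0" unfolding lo_def using ab m t by simp
  \<comment> \<open>The least \<open>l\<close> with \<open>N * l \<ge> lo\<close>: then
    \<open>1 + N * l\<close> exceeds \<open>lo\<close> by less than \<open>N + 1\<close>, and
    \<open>gap\<close> leaves room for that.\<close>
  define l where "l = nat \<lceil>lo / real N\<rceil>"
  have l1: "real l \<ge> lo / real N" unfolding l_def by linarith
  have l2: "real l < lo / real N + 1" 
  proof -
    have "\<lceil>lo / real N\<rceil> \<ge> 0" using lo ceiling_mono[of 0 "lo / real N"] by simp
    then have "real l = of_int \<lceil>lo / real N\<rceil>" by (simp add: l_def)
    then show ?thesis using ceiling_correct[of "lo / real N"] by linarith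
  qed
  define s where "s = 1 + N * l"
  have s1: "real s > lo" using l1 N by (simp add: s_def field_simps)
  have "real N * real l < lo + real N" using l2 N by (simp add: field_simps)
  then have s2: "real s < hi" using gap N by (simp add: s_def)
  have s0: "s > 0" by (simp add: s_def)
  show ?thesis
  proof (rule that[OF s0 t_def])
    show "int N dvd int s - 1" by (simp add: s_def)
    show "a < real t * sqrt (real m) / real s"
      using s2 s0 ab by (simp add: hi_def field_simps)
    show "real t * sqrt (real m) / real s < b"
      using s1 s0 ab by (simp add: lo_def field_simps)
  qed
qed

text \<open>Modulo a prime ideal above \<open>q\<close> the quotient \<open>u / v\<close> has exact
  order \<open>M\<close>. The Frobenius fixes \<open>u\<close> and \<open>v\<close> if
  \<open>- m\<close> is a residue and swaps them otherwise, so \<open>M\<close> divides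
  \<open>q - 1\<close> or \<open>q + 1\<close>.\<close>

lemma prime_dvd_form_value:
  fixes m M q s t :: nat and f :: "int poly"
  defines "\<theta> \<equiv> \<i> * of_real (sqrt (real m))"
  assumes M: "M > 0"
    and f: "f dvd Polynomial.monom 1 M - 1"
    and primitive: "\<And>g. g dvd M \<Longrightarrow> g < M \<Longrightarrow> f dvd (\<Sum>j<M div g. Polynomial.monom 1 (g * j))"
    and refl: "reflect_poly f = f"
    and q: "prime q" "\<not> q dvd 2 * m * M * t"
    and val: "hom_eval f (Polynomial.degree f) (of_nat s + of_nat t * \<theta>) (of_nat s - of_nat t * \<theta>) = of_int V"
    and V: "int q dvd V"
  shows "M dvd q - 1 \<or> M dvd q + 1 \<and> int q dvd (- int m) ^ ((q - 1) div 2) + 1"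
proof -
  let ?S = "quadratic_order \<theta>" and ?n = "Polynomial.degree f"
  have m: "m > 0" using q by (auto intro: Nat.gr0I)
  have nq: "\<not> q dvd 2" "\<not> q dvd m" "\<not> q dvd M" "\<not> q dvd t"
    using q by (simp_all add: prime_dvd_mult_iff)
  have odd: "odd q" using nq(1) primes_dvd_imp_eq[of 2 q] q(1) by auto
  have \<theta>2: "\<theta> * \<theta> = of_int (- int m)"
    by (simp add: \<theta>_def complex_eq_iff)
  interpret S: subring_set ?S by (rule subring_quadratic_order[OF \<theta>2])
  have \<theta>S: "\<theta> \<in> ?S" unfolding quadratic_order_def by (intro CollectI exI[of _ 0] exI[of _ 1]) simp
  interpret qS: ideal_set ?S "{of_nat q * z | z. z \<in> ?S}"
    by (rule S.principal_ideal_set[OF S.of_nat_mem])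
  have "1 \<notin> {of_nat q * z | z. z \<in> ?S}"
  proof
    assume "1 \<in> {of_nat q * z | z. z \<in> ?S}"
    then obtain a b where "1 = of_nat q * (of_int a + of_int b * \<theta>)" by (auto simp: quadratic_order_def)
    then have "1 = real q * of_int a" by (simp add: complex_eq_iff \<theta>_def)
    then have "int q * a = 1" by (metis of_int_1 of_int_eq_iff of_int_mult of_int_of_nat_eq)
    then have "int q dvd 1" by (metis dvd_triv_left)
    then show False using q(1) by auto
  qed
  then obtain P where P: "prime_ideal_set ?S P" "{of_nat q * z | z. z \<in> ?S} \<subseteq> P"
    using qS.ex_prime_ideal by blast
  interpret P: prime_ideal_set ?S P by (rule P(1))
  have qP: "of_nat q * z \<in> P" if "z \<in> ?S" for z using P(2) that by blast
  then have qP1: "of_nat q \<in> P" using qP[OF S.one_mem] by simp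
  note nat_iff = P.of_nat_mem_iff[OF q(1) qP1] and int_iff = P.of_int_mem_iff[OF q(1) qP1]
  define u where "u = of_nat s + of_nat t * \<theta>"
  define v where "v = of_nat s - of_nat t * \<theta>"
  have uS: "u \<in> ?S" and vS: "v \<in> ?S" unfolding u_def v_def by (intro S.mem_intros \<theta>S)+
  have root: "hom_eval f ?n u v \<in> P" unfolding u_def v_def val int_iff by (rule V)
  \<comment> \<open>The constant coefficient of \<open>X ^ M - 1\<close> is
    \<open>-1\<close>.\<close>
  have unit: "poly.coeff f 0 dvd 1"
  proof -
    obtain h where "Polynomial.monom 1 M - 1 = f * h" using f by (elim dvdE)
    from arg_cong[OF this, of "\<lambda>g. poly.coeff g 0"] have "poly.coeff f 0 * poly.coeff h 0 = - 1"
      using M by (simp add: coeff_mult)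
    then show ?thesis by (metis dvd_minus_iff dvd_triv_left)
  qed
  \<comment> \<open>If \<open>x\<close> is in \<open>P\<close>, the form reduces to a unit times a
    power of \<open>y\<close>, which forces \<open>y\<close> into \<open>P\<close> too.\<close>
  have both: "y \<in> P" if x: "x \<in> P" "hom_eval f ?n x y \<in> P" "y \<in> ?S" for x y
  proof -
    have xS: "x \<in> ?S" using x(1) P.ideal_subset by blast
    have "hom_eval f ?n x y - hom_eval f ?n 0 y \<in> P"
      using x xS by (intro P.hom_eval_cong) (auto intro: S.zero_mem P.ideal_zero)
    then have "hom_eval f ?n 0 y \<in> P" using x(2) P.cong_mem P.cong_sym by blast
    then have "of_int (poly.coeff f 0) * y ^ ?n \<in> P" by (simp add: hom_eval_zero_left)
    moreover have "of_int (poly.coeff f 0) \<notin> P"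
      unfolding int_iff using dvd_trans[OF _ unit, of "int q"] q(1) by auto
    ultimately show ?thesis
      using P.prime_ideal P.prime_ideal_power x(3) S.power_mem S.of_int_mem by blast
  qed
  \<comment> \<open>Otherwise \<open>(u - v) * \<theta> = - 2 * t * m\<close> would be in
    \<open>P\<close>, although \<open>q\<close> is prime to it.\<close>
  have not_both: "\<not> (u \<in> P \<and> v \<in> P)"
  proof
    assume "u \<in> P \<and> v \<in> P"
    then have "(u - v) * \<theta> \<in> P" using P.ideal_mult'[OF P.ideal_diff \<theta>S] by blast
    also have "(u - v) * \<theta> = 2 * of_nat t * (\<theta> * \<theta>)"
      by (simp add: u_def v_def algebra_simps)
    also have "\<dots> = of_int (- (2 * int t * int m))" unfolding \<theta>2 by simp
    finally have "int q dvd int (2 * t * m)" unfolding int_iff by simp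
    then have "q dvd 2 * t * m" by (simp only: int_dvd_int_iff)
    then show False using nq by (simp add: prime_dvd_mult_iff q(1))
  qed
  have uv: "u \<notin> P" "v \<notin> P"
    using both[of u v] both[of v u] not_both root uS vS hom_eval_swap[OF refl, of u v] by auto
  have M': "of_nat M \<notin> P" unfolding nat_iff by (rule nq)
  note crit = dvd_of_hom_eval_mem[OF P(1) M M' f primitive uS vS uv root]
  have frob: "x ^ q - (of_int a + of_int (b * (- int m) ^ ((q - 1) div 2)) * \<theta>) \<in> P"
    if "x = of_int a + of_int b * \<theta>" for x a b
    using frobenius_quadratic_order[OF \<theta>2 q(1) odd, of a b] qP unfolding that by auto
  have uq: "u ^ q - (of_int (int s) + of_int (int t * (- int m) ^ ((q - 1) div 2)) * \<theta>) \<in> P"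
    by (rule frob) (simp add: u_def)
  have vq: "v ^ q - (of_int (int s) + of_int (- int t * (- int m) ^ ((q - 1) div 2)) * \<theta>) \<in> P"
    by (rule frob) (simp add: v_def)
  let ?L = "(- int m) ^ ((q - 1) div 2)"
  have "\<not> int q dvd - int m" using nq by simp
  then consider "int q dvd ?L - 1" | "int q dvd ?L + 1" using euler_dichotomy[OF q(1) odd] by blast
  then show ?thesis
  proof cases
    case 1
    then have L: "of_int (?L - 1) \<in> P" unfolding int_iff .
    have fix_mod: "x ^ (q - 1) - 1 \<in> P"
      if x: "x ^ q - (of_int (int s) + of_int (k * ?L) * \<theta>) \<in> P" "x = of_nat s + of_int k * \<theta>" "x \<in> ?S" "x \<notin> P" for x k
    proof -
      have "of_int (int s) + of_int (k * ?L) * \<theta> - x = of_int (?L - 1) * (of_int k * \<theta>)"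
        by (simp add: x(2) algebra_simps)
      also have "\<dots> \<in> P" by (rule P.ideal_mult'[OF L]) (intro S.mem_intros \<theta>S)
      finally have "x ^ q - x \<in> P" using x(1) P.cong_trans by blast
      also have "x ^ q - x = x * (x ^ (q - 1) - 1)"
        using odd by (simp add: algebra_simps odd_pos flip: power_Suc)
      finally show ?thesis using P.prime_ideal[of x "x ^ (q - 1) - 1"] x(3,4) by (auto intro: S.mem_intros)
    qed
    have "u ^ (q - 1) - 1 \<in> P" by (rule fix_mod[OF uq _ uS uv(1)]) (simp add: u_def)
    moreover have "v ^ (q - 1) - 1 \<in> P" by (rule fix_mod[OF vq _ vS uv(2)]) (simp add: v_def)
    ultimately have "u ^ (q - 1) - v ^ (q - 1) \<in> P" using P.cong_trans P.cong_sym by blast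
    then show ?thesis using crit by blast
  next
    case 2
    then have L: "of_int (?L + 1) \<in> P" unfolding int_iff .
    have A: "x ^ q - (of_nat s - of_int k * \<theta>) \<in> P"
      if x: "x ^ q - (of_int (int s) + of_int (k * ?L) * \<theta>) \<in> P" for x k
    proof -
      have "of_int (int s) + of_int (k * ?L) * \<theta> - (of_nat s - of_int k * \<theta>) = of_int (?L + 1) * (of_int k * \<theta>)"
        by (simp add: algebra_simps)
      also have "\<dots> \<in> P" by (rule P.ideal_mult'[OF L]) (intro S.mem_intros \<theta>S)
      finally show ?thesis using x P.cong_trans by blast
    qed
    \<comment> \<open>The Frobenius swaps \<open>u\<close> and \<open>v\<close>, so
      \<open>u ^ (q + 1)\<close> and \<open>v ^ (q + 1)\<close> are both \<open>u * v\<close> modulo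
      \<open>P\<close>.\<close>
    have "u ^ q - v \<in> P" using A[OF uq] by (simp add: v_def)
    moreover have "v ^ q - u \<in> P" using A[OF vq] by (simp add: u_def)
    ultimately have "u * (u ^ q - v) - v * (v ^ q - u) \<in> P"
      using uS vS by (intro P.ideal_diff[OF P.ideal_mult P.ideal_mult])
    also have "u * (u ^ q - v) - v * (v ^ q - u) = u ^ (q + 1) - v ^ (q + 1)"
      by (simp add: algebra_simps)
    finally show ?thesis using crit 2 by blast
  qed
qed

text \<open>The form takes a negative value \<open>p * (1 + N * w)\<close> with
  \<open>p = poly f 1\<close>. Then \<open>K = - (1 + N * w)\<close> is \<open>-1\<close> modulo
  \<open>M\<close> and has a prime factor that is not \<open>1\<close> modulo \<open>M\<close>; by
  \<open>prime_dvd_form_value\<close> that factor is as wanted.\<close>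

theorem ex_inert_prime_minus_one_mod:
  fixes m M B :: nat
  assumes m: "m > 0" and M: "M \<ge> 3"
  obtains q where "prime q" "odd q" "q > B" "M dvd q + 1" "int q dvd (- int m) ^ ((q - 1) div 2) + 1"
proof -
  obtain f :: "int poly" where f: "f dvd Polynomial.monom 1 M - 1"
    and primitive: "\<And>g. g dvd M \<Longrightarrow> g < M \<Longrightarrow> f dvd (\<Sum>j<M div g. Polynomial.monom 1 (g * j))"
    and refl: "reflect_poly f = f" and p1: "poly f 1 > 0"
    and root: "poly (map_poly of_int f) (cis (2 * pi / real M)) = 0"
    and der: "poly (pderiv (map_poly of_int f)) (cis (2 * pi / real M)) \<noteq> 0"
    using ex_primitive_palindromic_factor[OF M] by blast
  let ?n = "Polynomial.degree f"
  obtain a b where ab: "0 < a" "a < b"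
    and neg: "\<And>x. a < x \<Longrightarrow> x < b \<Longrightarrow> Re (hom_eval f ?n (1 + \<i> * of_real x) (1 - \<i> * of_real x)) < 0"
    using hom_eval_negative_interval[OF M refl root der] by blast
  define p where "p = nat (poly f 1)"
  have p: "p > 0" "poly f 1 = int p" using p1 by (auto simp: p_def)
  \<comment> \<open>A prime that does not divide \<open>N\<close> avoids \<open>2\<close>,
    \<open>m\<close>, \<open>M\<close> and \<open>p\<close>, and exceeds \<open>B\<close> because of
    the factor \<open>fact B\<close>.\<close>
  define N where "N = 2 * m * M * p * fact B"
  have N0: "N > 0" using m M p by (simp add: N_def)
  then have N: "N \<ge> 2" unfolding N_def by (cases "m * M * p * fact B") (auto simp: mult.assoc)
  obtain s t j :: nat where s: "s > 0" and tN: "t = N ^ (j + 2)" and sN: "int N dvd int s - 1"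
    and x: "a < real t * sqrt (real m) / real s" "real t * sqrt (real m) / real s < b"
    using negative_value_in_progression[OF ab N m] by blast
  have t: "t > 0" using N0 by (simp add: tN)
  define \<theta> where "\<theta> = \<i> * of_real (sqrt (real m))"
  have \<theta>2: "\<theta> * \<theta> = of_int (- int m)"
    by (simp add: \<theta>_def complex_eq_iff)
  interpret S: subring_set "quadratic_order \<theta>" by (rule subring_quadratic_order[OF \<theta>2])
  have \<theta>S: "\<theta> \<in> quadratic_order \<theta>" unfolding quadratic_order_def by (intro CollectI exI[of _ 0] exI[of _ 1]) simp
  define u where "u = of_nat s + of_nat t * \<theta>"
  define v where "v = of_nat s - of_nat t * \<theta>"
  have uS: "u \<in> quadratic_order \<theta>" and vS: "v \<in> quadratic_order \<theta>"
    unfolding u_def v_def by (intro S.mem_intros \<theta>S)+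
  have cnj: "cnj u = v" "cnj v = u" by (simp_all add: u_def v_def \<theta>_def complex_eq_iff)
  define H where "H = hom_eval f ?n u v"
  have "cnj H = H" unfolding H_def cnj_hom_eval cnj by (rule hom_eval_swap[OF refl])
  then have ImH: "Im H = 0" by (simp add: complex_eq_iff)
  interpret tS: ideal_set "quadratic_order \<theta>" "{of_nat t * z | z. z \<in> quadratic_order \<theta>}"
    by (rule S.principal_ideal_set[OF S.of_nat_mem])
  \<comment> \<open>Modulo \<open>t\<close> both arguments are \<open>s\<close>, so the value is
    \<open>poly f 1 * s ^ ?n\<close>.\<close>
  have "H - hom_eval f ?n (of_nat s) (of_nat s) \<in> {of_nat t * z | z. z \<in> quadratic_order \<theta>}"
    unfolding H_def
  proof (rule tS.hom_eval_cong[OF _ _ uS vS S.of_nat_mem S.of_nat_mem])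
    show "u - of_nat s \<in> {of_nat t * z | z. z \<in> quadratic_order \<theta>}"
      using \<theta>S by (auto simp: u_def)
    show "v - of_nat s \<in> {of_nat t * z | z. z \<in> quadratic_order \<theta>}"
      using S.uminus_mem[OF \<theta>S] by (auto simp: v_def intro!: exI[of _ "- \<theta>"])
  qed
  then obtain c d where cd: "H - hom_eval f ?n (of_nat s) (of_nat s) = of_nat t * (of_int c + of_int d * \<theta>)"
    unfolding quadratic_order_def by blast
  have "of_int (poly f 1) * of_nat s ^ ?n = (of_int (int p * int s ^ ?n) :: complex)" by (simp add: p)
  then have H1: "H = of_int (int p * int s ^ ?n) + of_nat t * (of_int c + of_int d * \<theta>)"
    using cd unfolding hom_eval_diag by (simp add: algebra_simps)
  \<comment> \<open>\<open>H\<close> is real, which kills the coefficient of \<open>\<theta>\<close>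
    and leaves an integer.\<close>
  have "Im (of_nat t * (of_int d * \<theta>)) = Im H" unfolding H1 by (simp add: \<theta>_def)
  then have "real t * (of_int d * sqrt (real m)) = 0" using ImH by (simp add: \<theta>_def)
  then have "d = 0" using t m by simp
  define V where "V = int p * int s ^ ?n + int t * c"
  have HV: "H = of_int V" unfolding H1 \<open>d = 0\<close> V_def by simp
  have Vneg: "V < 0"
  proof -
    define y where "y = real t * sqrt (real m) / real s"
    have sy: "real s * y = real t * sqrt (real m)" using s by (simp add: y_def)
    \<comment> \<open>Dividing by \<open>s\<close> moves \<open>u\<close> to
      \<open>1 + \<i> * y\<close>, with \<open>y\<close> in the interval where the form is
      negative.\<close>
    have "of_nat s * (\<i> * of_real y) = of_nat t * \<theta>"
      unfolding \<theta>_def using sy by (simp add: complex_eq_iff)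
    then have "u = of_nat s * (1 + \<i> * of_real y)" "v = of_nat s * (1 - \<i> * of_real y)"
      unfolding u_def v_def by (simp_all add: algebra_simps)
    then have "H = of_nat s ^ ?n * hom_eval f ?n (1 + \<i> * of_real y) (1 - \<i> * of_real y)"
      unfolding H_def by (simp add: hom_eval_scale)
    also have "of_nat s ^ ?n = complex_of_real (real s ^ ?n)" by simp
    finally have "Re H = real s ^ ?n * Re (hom_eval f ?n (1 + \<i> * of_real y) (1 - \<i> * of_real y))"
      by (simp only: Re_complex_of_real Im_complex_of_real times_complex.simps)
    also have "\<dots> < 0" using neg[of y] x s by (intro mult_pos_neg) (auto simp: y_def)
    finally show ?thesis by (simp add: HV)
  qed
  obtain k where k: "int s ^ ?n - 1 = int N * k"
  proof -
    have "int s - 1 dvd int s ^ ?n - 1 ^ ?n" unfolding power_diff_sumr2 by simp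
    then show ?thesis using sN that by (metis dvd_def dvd_trans power_one)
  qed
  \<comment> \<open>\<open>p\<close> divides \<open>N\<close> and \<open>t\<close> is a multiple of
    \<open>N * N\<close>; so \<open>p\<close> can be split off from the value with a cofactor that
    is \<open>1\<close> modulo \<open>N\<close>.\<close>
  obtain t' where t': "t = N * (p * t')"
  proof -
    have "N * p dvd N * N" by (simp add: N_def)
    then have "N * p dvd t" unfolding tN by (simp add: mult.assoc[symmetric])
    then obtain t' where "t = N * p * t'" ..
    then show ?thesis using that[of t'] by (simp add: mult.assoc)
  qed
  define w where "w = k + int t' * c"
  have sk: "int s ^ ?n = 1 + int N * k" using k by simp
  have V: "V = int p * (1 + int N * w)"
    unfolding V_def sk t' w_def by (simp add: algebra_simps)
  then have wneg: "1 + int N * w < 0" using Vneg p(1) by (simp add: mult_less_0_iff)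
  define K where "K = nat (- (1 + int N * w))"
  have K: "K > 0" "int K = - (1 + int N * w)" using wneg by (simp_all add: K_def)
  have MN: "int M dvd int N" by (simp add: N_def)
  \<comment> \<open>\<open>K\<close> is \<open>-1\<close> modulo \<open>M\<close>, and
    \<open>M \<ge> 3\<close> separates \<open>-1\<close> from \<open>1\<close>.\<close>
  have "\<not> int M dvd int K - 1"
  proof
    assume "int M dvd int K - 1"
    moreover have "int K - 1 = - 2 + int N * (- w)" using K by simp
    moreover have "int M dvd int N * (- w)" using MN by simp
    ultimately have "int M dvd - 2" by (metis dvd_add_left_iff)
    then have "int M \<le> 2" by (intro zdvd_imp_le) auto
    then show False using M by simp
  qed
  then obtain q where q: "prime q" "q dvd K" "\<not> int M dvd int q - 1"
    using nat_cong_1_of_prime_factors[OF K(1), of M] by blast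
  have qK: "int q dvd 1 + int N * w" using q(2) K(2)
    by (metis dvd_minus_iff int_dvd_int_iff)
  have qN: "\<not> q dvd N"
  proof
    assume "q dvd N"
    then have "int q dvd int N * w" by simp
    then have "int q dvd 1" using qK by (simp add: dvd_add_left_iff)
    then show False using q(1) by auto
  qed
  have qn: "\<not> q dvd 2" "\<not> q dvd m" "\<not> q dvd M" "\<not> q dvd p" "\<not> q dvd fact B"
    using qN by (auto simp: N_def)
  have qt: "\<not> q dvd t" unfolding tN using qN q(1) prime_dvd_power by blast
  have qB: "q > B" using qn(5) q(1) prime_gt_0_nat[OF q(1)] by (simp add: prime_dvd_fact_iff)
  have "M dvd q - 1 \<or> M dvd q + 1 \<and> int q dvd (- int m) ^ ((q - 1) div 2) + 1"
  proof (rule prime_dvd_form_value[OF _ f primitive refl q(1)])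
    show "\<not> q dvd 2 * m * M * t" using qn qt q(1) by (simp add: prime_dvd_mult_iff)
    show "hom_eval f ?n (of_nat s + of_nat t * (\<i> * complex_of_real (sqrt (real m))))
       (of_nat s - of_nat t * (\<i> * complex_of_real (sqrt (real m)))) = of_int V"
      using HV unfolding H_def u_def v_def \<theta>_def .
    show "int q dvd V" unfolding V using qK by simp
  qed (use M in auto)
  moreover have "\<not> M dvd q - 1"
  proof
    assume "M dvd q - 1"
    then have "int M dvd int (q - 1)" by (simp only: int_dvd_int_iff)
    then show False using q(3) prime_gt_0_nat[OF q(1)] by (simp add: of_nat_diff)
  qed
  moreover have "odd q" using qn(1) primes_dvd_imp_eq[of 2 q] q(1) by auto
  ultimately show ?thesis using that[of q] q(1) qB by blast
qed

section \<open>Integers of an imaginary quadratic field\<close>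

text \<open>Every power of the reduced denominator \<open>b\<close> divides \<open>D\<close>; as
  \<open>2 ^ D > D\<close>, this forces \<open>b = 1\<close>.\<close>

lemma rat_int_of_bounded_denominators:
  fixes x :: rat
  assumes "D > 0" "\<And>k. of_nat D * x ^ k \<in> \<int>"
  shows "x \<in> \<int>"
proof -
  obtain a b where ab: "quotient_of x = (a, b)" by (cases "quotient_of x")
  have b: "b > 0" "coprime a b" "x = of_int a / of_int b"
    using quotient_of_denom_pos[OF ab] quotient_of_coprime[OF ab] quotient_of_div[OF ab] by auto
  have dvd: "b ^ k dvd int D" for k
  proof -
    obtain c where c: "of_nat D * x ^ k = of_int c" using assms(2)[of k] by (elim Ints_cases)
    have "(of_int (int D * a ^ k) :: rat) = of_int (c * b ^ k)"
      using c b(1) by (simp add: b(3) field_simps power_divide)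
    then have "int D * a ^ k = c * b ^ k" by (simp only: of_int_eq_iff)
    then have "b ^ k dvd int D * a ^ k" by simp
    moreover have "coprime (b ^ k) (a ^ k)" using b(2) by (simp add: coprime_commute)
    ultimately show ?thesis by (simp add: coprime_dvd_mult_left_iff)
  qed
  have "b = 1"
  proof (rule ccontr)
    assume "b \<noteq> 1"
    then have "b \<ge> 2" using b(1) by simp
    then have "2 ^ D \<le> b ^ D" by (intro power_mono) auto
    moreover have "b ^ D \<le> int D" using dvd[of D] assms(1) by (intro zdvd_imp_le) auto
    moreover have "int D < 2 ^ D" using less_exp[of D] by (metis of_nat_less_iff of_nat_numeral of_nat_power)
    ultimately show False by linarith
  qed
  then show ?thesis using b(3) by simp
qed

text \<open>\<open>\<theta>\<close> stands for \<open>sqrt (- m)\<close>. Since \<open>m\<close> may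
  have square factors and half-integral coordinates may occur,
  \<open>quadratic_order \<theta>\<close> can be smaller than the ring of integers.\<close>

locale imaginary_quadratic =
  fixes \<theta> :: "'a::field_char_0" and m :: nat
  assumes theta_square: "\<theta> * \<theta> = - of_nat m" and m_pos: "m > 0"
begin

definition field_set :: "'a set" where
  "field_set = {of_rat r + of_rat s * \<theta> | r s. True}"

lemma theta_square': "\<theta> * \<theta> = of_int (- int m)"
  by (simp add: theta_square)

sublocale order: subring_set "quadratic_order \<theta>"
  by (rule subring_quadratic_order[OF theta_square'])

lemma coord_zero: "of_rat r + of_rat s * \<theta> = 0 \<longleftrightarrow> r = 0 \<and> s = 0"
proof
  assume 0: "of_rat r + of_rat s * \<theta> = 0"
  then have "of_rat s * \<theta> = - of_rat r" by (simp add: eq_neg_iff_add_eq_0 add.commute)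
  then have "(of_rat s * \<theta>) * (of_rat s * \<theta>) = of_rat r * of_rat r" by simp
  also have "(of_rat s * \<theta>) * (of_rat s * \<theta>) = of_rat s * of_rat s * (\<theta> * \<theta>)" by (simp add: mult_ac)
  finally have "(of_rat (- (s * s * of_nat m)) :: 'a) = of_rat (r * r)"
    by (simp add: theta_square of_rat_mult of_rat_minus)
  then have "- (s * s * of_nat m) = r * r" by (simp only: of_rat_eq_iff)
  then have "r * r + of_nat m * (s * s) = 0" by (simp add: algebra_simps)
  moreover have "r * r \<ge> 0" "of_nat m * (s * s) \<ge> 0" by simp_all
  ultimately have "r * r = 0" "of_nat m * (s * s) = 0" by linarith+
  then show "r = 0 \<and> s = 0" using m_pos by simp
qed simp

lemma coord_eq: "of_rat r + of_rat s * \<theta> = of_rat r' + of_rat s' * \<theta> \<longleftrightarrow> r = r' \<and> s = s'"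
  using coord_zero[of "r - r'" "s - s'"] by (simp add: of_rat_diff algebra_simps)

text \<open>Both \<open>conjugate\<close> and \<open>nm\<close> are junk outside \<open>field_set\<close>.\<close>

definition conjugate :: "'a \<Rightarrow> 'a" where
  "conjugate x = (THE y. \<exists>r s. x = of_rat r + of_rat s * \<theta> \<and> y = of_rat r - of_rat s * \<theta>)"

definition nm :: "'a \<Rightarrow> rat" where
  "nm x = (THE n. \<exists>r s. x = of_rat r + of_rat s * \<theta> \<and> n = r * r + of_nat m * (s * s))"

lemma conj_coord: "conjugate (of_rat r + of_rat s * \<theta>) = of_rat r - of_rat s * \<theta>"
  unfolding conjugate_def by (rule the_equality) (auto simp: coord_eq)

lemma nm_coord: "nm (of_rat r + of_rat s * \<theta>) = r * r + of_nat m * (s * s)"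
  unfolding nm_def by (rule the_equality) (auto simp: coord_eq)

lemma field_setE:
  assumes "x \<in> field_set"
  obtains r s where "x = of_rat r + of_rat s * \<theta>"
  using assms unfolding field_set_def by blast

lemma field_setI: "x = of_rat r + of_rat s * \<theta> \<Longrightarrow> x \<in> field_set"
  unfolding field_set_def by blast

lemma mult_coord: "(of_rat r + of_rat s * \<theta>) * (of_rat r' + of_rat s' * \<theta>) =
    of_rat (r * r' - of_nat m * (s * s')) + of_rat (r * s' + s * r') * \<theta>"
proof -
  have "(of_rat r + of_rat s * \<theta>) * (of_rat r' + of_rat s' * \<theta>) =
    of_rat r * of_rat r' + (of_rat r * of_rat s' + of_rat s * of_rat r') * \<theta> + of_rat s * of_rat s' * (\<theta> * \<theta>)"
    by (simp add: algebra_simps)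
  then show ?thesis
    by (simp add: theta_square of_rat_mult of_rat_add of_rat_diff algebra_simps)
qed

lemma diff_coord: "(of_rat r + of_rat s * \<theta>) - (of_rat r' + of_rat s' * \<theta>) =
    of_rat (r - r') + of_rat (s - s') * \<theta>"
  by (simp add: of_rat_diff algebra_simps)

lemma conj_coord': "conjugate (of_rat r + of_rat s * \<theta>) = of_rat r + of_rat (- s) * \<theta>"
  by (simp add: conj_coord of_rat_minus)

lemma field_set_subring: "subring_set field_set"
proof
  show "1 \<in> field_set" by (rule field_setI[of _ 1 0]) simp
  fix x y assume "x \<in> field_set" "y \<in> field_set"
  then obtain r s r' s' where "x = of_rat r + of_rat s * \<theta>" "y = of_rat r' + of_rat s' * \<theta>"
    by (meson field_setE)
  then show "x - y \<in> field_set" "x * y \<in> field_set"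
    by (auto simp: diff_coord mult_coord intro: field_setI)
qed

sublocale fld: subring_set field_set by (rule field_set_subring)

lemma conj_mem_field: "x \<in> field_set \<Longrightarrow> conjugate x \<in> field_set"
  by (elim field_setE) (auto simp: conj_coord' intro: field_setI)

lemma conj_conj: "x \<in> field_set \<Longrightarrow> conjugate (conjugate x) = x"
  by (elim field_setE) (simp add: conj_coord')

lemma conj_mult: "x \<in> field_set \<Longrightarrow> y \<in> field_set \<Longrightarrow> conjugate (x * y) = conjugate x * conjugate y"
  by (elim field_setE) (simp add: conj_coord' mult_coord)

lemma conj_diff: "x \<in> field_set \<Longrightarrow> y \<in> field_set \<Longrightarrow> conjugate (x - y) = conjugate x - conjugate y"
  by (elim field_setE) (simp add: conj_coord' diff_coord)

lemma conj_of_rat: "conjugate (of_rat r) = of_rat r"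
  using conj_coord[of r 0] by simp

lemma conj_of_int: "conjugate (of_int k) = of_int k"
  using conj_of_rat[of "of_int k"] by simp

lemma conj_of_nat: "conjugate (of_nat k) = of_nat k"
  using conj_of_int[of "int k"] by simp

lemma conj_one: "conjugate 1 = 1"
  using conj_of_int[of 1] by simp

lemma conj_power: "x \<in> field_set \<Longrightarrow> conjugate (x ^ n) = conjugate x ^ n"
  by (induction n) (simp_all add: conj_one conj_mult fld.power_mem)

lemma mult_conj: "x \<in> field_set \<Longrightarrow> x * conjugate x = of_rat (nm x)"
  by (elim field_setE) (simp add: nm_coord conj_coord' mult_coord)

lemma nm_mult: "x \<in> field_set \<Longrightarrow> y \<in> field_set \<Longrightarrow> nm (x * y) = nm x * nm y"
  by (elim field_setE) (simp add: nm_coord mult_coord, simp add: algebra_simps)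

lemma nm_of_rat: "nm (of_rat r) = r * r"
  using nm_coord[of r 0] by simp

lemma nm_of_nat: "nm (of_nat r) = of_nat r * of_nat r"
  using nm_of_rat[of "of_nat r"] by simp

lemma nm_power: "x \<in> field_set \<Longrightarrow> nm (x ^ n) = nm x ^ n"
  using nm_of_nat[of 1] by (induction n) (simp_all add: nm_mult fld.power_mem)

lemma nm_nonneg: "x \<in> field_set \<Longrightarrow> nm x \<ge> 0"
  by (elim field_setE) (simp add: nm_coord)

lemma nm_eq_0_iff: "x \<in> field_set \<Longrightarrow> nm x = 0 \<longleftrightarrow> x = 0"
proof (elim field_setE)
  fix r s assume x: "x = of_rat r + of_rat s * \<theta>"
  have "r * r \<ge> 0" "of_nat m * (s * s) \<ge> 0" by simp_all
  then have "r * r + of_nat m * (s * s) = 0 \<longleftrightarrow> r * r = 0 \<and> of_nat m * (s * s) = 0" by linarith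
  then show ?thesis using m_pos by (simp add: x nm_coord coord_zero)
qed

lemma conj_mem_order: "x \<in> quadratic_order \<theta> \<Longrightarrow> conjugate x \<in> quadratic_order \<theta>"
proof -
  assume "x \<in> quadratic_order \<theta>"
  then obtain a b where "x = of_int a + of_int b * \<theta>" unfolding quadratic_order_def by blast
  then have "conjugate x = of_int a + of_int (- b) * \<theta>" using conj_coord[of "of_int a" "of_int b"] by simp
  then show ?thesis unfolding quadratic_order_def by blast
qed

lemma nm_order_Ints: "x \<in> quadratic_order \<theta> \<Longrightarrow> nm x \<in> \<int>"
proof -
  assume "x \<in> quadratic_order \<theta>"
  then obtain a b where "x = of_int a + of_int b * \<theta>" unfolding quadratic_order_def by blast
  then show ?thesis using nm_coord[of "of_int a" "of_int b"] by simp
qed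

lemma ex_denominator:
  assumes "x \<in> field_set"
  obtains c :: nat where "c > 0" "of_nat c * x \<in> quadratic_order \<theta>"
proof -
  obtain r s where x: "x = of_rat r + of_rat s * \<theta>" using assms by (elim field_setE)
  obtain a b where ab: "quotient_of r = (a, b)" by (cases "quotient_of r")
  obtain a' b' where ab': "quotient_of s = (a', b')" by (cases "quotient_of s")
  have b: "b > 0" "r = of_int a / of_int b" "b' > 0" "s = of_int a' / of_int b'"
    using quotient_of_denom_pos[OF ab] quotient_of_div[OF ab] quotient_of_denom_pos[OF ab'] quotient_of_div[OF ab'] by auto
  have x': "x = of_int a / of_int b + of_int a' / of_int b' * \<theta>"
    by (simp add: x b(2,4) of_rat_divide)
  have "of_nat (nat (b * b')) * x = of_int (b * b') * x" using b by simp
  also have "\<dots> = of_int (a * b') + of_int (a' * b) * \<theta>"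
    using b(1,3) unfolding x' by (simp add: field_simps)
  finally have "of_nat (nat (b * b')) * x \<in> quadratic_order \<theta>"
    unfolding quadratic_order_def by blast
  then show ?thesis using that[of "nat (b * b')"] b(1,3) by simp
qed

text \<open>
  Bounded denominators of all powers: equivalent to integrality by \<open>integers_eq\<close> below, and evidently
  stable under differences and products.
\<close>

definition integers :: "'a set" where
  "integers = {x. \<exists>D>0. \<forall>k. of_nat D * x ^ k \<in> quadratic_order \<theta>}"

lemma integers_subset_field: "integers \<subseteq> field_set"
proof
  fix x assume "x \<in> integers"
  then obtain D where D: "D > 0" "of_nat D * x ^ 1 \<in> quadratic_order \<theta>" unfolding integers_def by blast
  then obtain a b where "of_nat D * x = of_int a + of_int b * \<theta>" unfolding quadratic_order_def by auto
  then have "x = of_rat (of_int a / of_nat D) + of_rat (of_int b / of_nat D) * \<theta>"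
    using D(1) by (simp add: of_rat_divide field_simps)
  then show "x \<in> field_set" by (rule field_setI)
qed

lemma integers_subring: "subring_set integers"
proof
  show "1 \<in> integers" unfolding integers_def by (auto intro!: exI[of _ 1] order.one_mem)
  fix x y assume "x \<in> integers" "y \<in> integers"
  then obtain D E where D: "D > 0" "\<And>k. of_nat D * x ^ k \<in> quadratic_order \<theta>"
    and E: "E > 0" "\<And>k. of_nat E * y ^ k \<in> quadratic_order \<theta>" unfolding integers_def by blast
  have DE: "of_nat (D * E) * (x ^ i * y ^ j) \<in> quadratic_order \<theta>" for i j
    using order.mult_mem[OF D(2)[of i] E(2)[of j]] by (simp add: mult_ac)
  have "of_nat (D * E) * (x * y) ^ k \<in> quadratic_order \<theta>" for k
    using DE[of k k] by (simp add: power_mult_distrib)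
  then show "x * y \<in> integers" unfolding integers_def using D E by (auto intro!: exI[of _ "D * E"])
  have "of_nat (D * E) * (x - y) ^ k \<in> quadratic_order \<theta>" for k
  proof -
    have "of_nat (D * E) * (x + - y) ^ k = (\<Sum>i\<le>k. of_int (int (k choose i) * (- 1) ^ (k - i)) * (of_nat (D * E) * (x ^ i * y ^ (k - i))))"
      unfolding binomial_ring sum_distrib_left
      by (rule sum.cong) (simp_all add: power_minus[of y] mult_ac)
    also have "\<dots> \<in> quadratic_order \<theta>"
      by (intro order.sum_mem order.mult_mem[OF order.of_int_mem DE])
    finally show ?thesis by simp
  qed
  then show "x - y \<in> integers" unfolding integers_def using D E by (auto intro!: exI[of _ "D * E"])
qed

sublocale ints: subring_set integers by (rule integers_subring)

lemma conj_mem_integers: "x \<in> integers \<Longrightarrow> conjugate x \<in> integers"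
proof -
  assume x: "x \<in> integers"
  then obtain D where D: "D > 0" "\<And>k. of_nat D * x ^ k \<in> quadratic_order \<theta>" unfolding integers_def by blast
  have xf: "x \<in> field_set" using x integers_subset_field by blast
  have "of_nat D * conjugate x ^ k \<in> quadratic_order \<theta>" for k
    using conj_mem_order[OF D(2)[of k]] xf by (simp add: conj_mult fld.mem_intros conj_of_nat conj_power)
  then show ?thesis unfolding integers_def using D by blast
qed

text \<open>The norm of \<open>D * x ^ k\<close> is \<open>D * D\<close> times the
  \<open>k\<close>-th power of \<open>nm x\<close>, so all powers of \<open>nm x\<close> share a
  denominator.\<close>

lemma nm_integers: "x \<in> integers \<Longrightarrow> nm x \<in> \<int>"
proof -
  assume x: "x \<in> integers"
  then obtain D where D: "D > 0" "\<And>k. of_nat D * x ^ k \<in> quadratic_order \<theta>" unfolding integers_def by blast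
  have xf: "x \<in> field_set" using x integers_subset_field by blast
  have "of_nat (D * D) * nm x ^ k \<in> \<int>" for k
    using nm_order_Ints[OF D(2)[of k]] xf by (simp add: nm_mult fld.mem_intros nm_of_nat nm_power)
  then show ?thesis by (rule rat_int_of_bounded_denominators[rotated]) (simp add: D(1))
qed

text \<open>The trace is recovered from two norms as \<open>1 + nm x - nm (1 - x)\<close>.\<close>

lemma trace_integers:
  assumes "x \<in> integers"
  obtains t :: int where "x + conjugate x = of_int t"
proof -
  have xf: "x \<in> field_set" using assms integers_subset_field by blast
  have 1: "1 - x \<in> integers" using assms by (intro ints.mem_intros)
  obtain n n' where n: "nm x = of_int n" "nm (1 - x) = of_int n'"
    using nm_integers[OF assms] nm_integers[OF 1] by (auto elim!: Ints_cases)
  have "(1 - x) * (1 - conjugate x) = of_rat (nm (1 - x))"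
    using mult_conj[of "1 - x"] xf by (simp add: conj_diff conj_one fld.mem_intros)
  then have "x + conjugate x = 1 + x * conjugate x - of_int n'" by (simp add: algebra_simps n)
  then have "x + conjugate x = of_int (1 + n - n')" using mult_conj[OF xf] n by simp
  then show ?thesis by (rule that)
qed

text \<open>An element of \<open>integers\<close> is a root of the monic quadratic formed from its
  trace and norm. Conversely, a monic equation of degree \<open>d\<close> reduces high powers to
  those below \<open>d\<close>, whose denominators \<open>c ^ d\<close> clears.\<close>

theorem integers_eq: "integers = {x \<in> field_set. algebraic_int x}"
proof (rule Set.set_eqI, rule iffI)
  fix x assume x: "x \<in> integers"
  then have xf: "x \<in> field_set" using integers_subset_field by blast
  obtain t where t: "x + conjugate x = of_int t" using trace_integers[OF x] .
  obtain n where n: "nm x = of_int n" using nm_integers[OF x] by (elim Ints_cases)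
  have "x * conjugate x = of_int n" using mult_conj[OF xf] n by simp
  then have root: "of_int n - of_int t * x + x * x = 0" by (simp flip: t add: algebra_simps)
  have "algebraic_int x"
  proof (rule algebraic_int.intros)
    show "lead_coeff [:of_int n, - of_int t, 1 :: 'a:] = 1" by simp
    show "\<forall>i. poly.coeff [:of_int n, - of_int t, 1 :: 'a:] i \<in> \<int>"
      by (auto simp: coeff_pCons split: nat.splits)
    show "poly [:of_int n, - of_int t, 1 :: 'a:] x = 0" using root by (simp add: algebra_simps)
  qed
  then show "x \<in> {x \<in> field_set. algebraic_int x}" using xf by simp
next
  fix x assume "x \<in> {x \<in> field_set. algebraic_int x}"
  then have xf: "x \<in> field_set" and "algebraic_int x" by auto
  then obtain p where p: "poly p x = 0" "lead_coeff p = 1" "\<And>i. poly.coeff p i \<in> \<int>"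
    by (auto elim!: algebraic_int.cases)
  let ?d = "Polynomial.degree p"
  obtain c where c: "c > 0" "of_nat c * x \<in> quadratic_order \<theta>" using ex_denominator[OF xf] .
  have "of_nat (c ^ ?d) * x ^ k \<in> quadratic_order \<theta>" for k
  proof (induction k rule: less_induct)
    case (less k)
    show ?case
    proof (cases "k < ?d")
      case True
      then have "c ^ ?d = c ^ (?d - k) * c ^ k" by (simp flip: power_add)
      then have "of_nat (c ^ ?d) * x ^ k = of_nat (c ^ (?d - k)) * (of_nat c * x) ^ k"
        by (simp add: power_mult_distrib mult.assoc)
      then show ?thesis using c by (auto intro!: order.mem_intros simp del: of_nat_power)
    next
      case False
      have "0 = x ^ (k - ?d) * (\<Sum>i\<le>?d. poly.coeff p i * x ^ i)"
        using p(1) by (simp add: poly_altdef)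
      also have "{..?d} = insert ?d {..<?d}" by auto
      also have "(\<Sum>i\<in>insert ?d {..<?d}. poly.coeff p i * x ^ i) = x ^ ?d + (\<Sum>i<?d. poly.coeff p i * x ^ i)"
        using p(2) by simp
      also have "x ^ (k - ?d) * (x ^ ?d + (\<Sum>i<?d. poly.coeff p i * x ^ i)) =
          x ^ (k - ?d + ?d) + (\<Sum>i<?d. poly.coeff p i * x ^ (k - ?d + i))"
        by (simp only: distrib_left sum_distrib_left power_add mult_ac)
      also have "k - ?d + ?d = k" using False by simp
      finally have "x ^ k = - (\<Sum>i<?d. poly.coeff p i * x ^ (k - ?d + i))"
        by (simp add: eq_neg_iff_add_eq_0)
      then have "of_nat (c ^ ?d) * x ^ k = - (\<Sum>i<?d. poly.coeff p i * (of_nat (c ^ ?d) * x ^ (k - ?d + i)))"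
        by (simp add: sum_distrib_left mult_ac)
      also have "\<dots> \<in> quadratic_order \<theta>"
      proof (rule order.uminus_mem, rule order.sum_mem, rule order.mult_mem)
        fix i assume i: "i \<in> {..<?d}"
        show "poly.coeff p i \<in> quadratic_order \<theta>" using p(3)[of i] by (auto elim!: Ints_cases simp: order.of_int_mem)
        show "of_nat (c ^ ?d) * x ^ (k - ?d + i) \<in> quadratic_order \<theta>"
          using i False by (intro less.IH) auto
      qed
      finally show ?thesis .
    qed
  qed
  then show "x \<in> integers" unfolding integers_def using c(1) by (intro CollectI exI[of _ "c ^ ?d"]) auto
qed

end

section \<open>The integer-valued norm and the Frobenius on integers\<close>

context imaginary_quadratic
begin

text \<open>The floor only changes the type on \<open>integers\<close>, where \<open>nm\<close> is
  already integral.\<close>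

definition N :: "'a \<Rightarrow> int" where
  "N x = \<lfloor>nm x\<rfloor>"

lemma of_int_N: "x \<in> integers \<Longrightarrow> of_int (N x) = nm x"
  using nm_integers unfolding N_def by (auto elim!: Ints_cases)

lemma integers_fieldD: "x \<in> integers \<Longrightarrow> x \<in> field_set"
  using integers_subset_field by blast

lemma mult_conjugate_N: "x \<in> integers \<Longrightarrow> x * conjugate x = of_int (N x)"
  using of_int_N[of x] mult_conj[OF integers_fieldD, of x] by (metis of_rat_of_int_eq)

lemma N_eqI: "x \<in> integers \<Longrightarrow> x * conjugate x = of_int k \<Longrightarrow> N x = k"
  using mult_conjugate_N[of x] by simp

lemma N_mult: "x \<in> integers \<Longrightarrow> y \<in> integers \<Longrightarrow> N (x * y) = N x * N y"
proof -
  assume xy: "x \<in> integers" "y \<in> integers"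
  have "(x * y) * conjugate (x * y) = (x * conjugate x) * (y * conjugate y)"
    using xy by (simp add: conj_mult integers_fieldD mult_ac)
  then show ?thesis using xy by (intro N_eqI) (simp_all add: mult_conjugate_N ints.mult_mem)
qed

lemma N_one: "N 1 = 1"
  by (rule N_eqI) (simp_all add: conj_one ints.one_mem)

lemma N_power: "x \<in> integers \<Longrightarrow> N (x ^ n) = N x ^ n"
  by (induction n) (simp_all add: N_one N_mult ints.power_mem)

lemma N_nonneg: "x \<in> integers \<Longrightarrow> N x \<ge> 0"
  using nm_nonneg[OF integers_fieldD, of x] by (simp add: N_def)

lemma N_pos: "x \<in> integers \<Longrightarrow> x \<noteq> 0 \<Longrightarrow> N x > 0"
  using of_int_N[of x] N_nonneg[of x] nm_eq_0_iff[OF integers_fieldD, of x]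
  by (cases "N x = 0") auto

text \<open>On expansion the cross terms are \<open>k\<close> times the trace of
  \<open>x * conjugate w\<close>, which is an integer.\<close>

lemma N_cong:
  assumes x: "x \<in> integers" and w: "w \<in> integers"
  shows "k dvd N (x + of_int k * w) - N x"
proof -
  have xw: "x * conjugate w \<in> integers" using x w by (intro ints.mult_mem conj_mem_integers)
  obtain t where t: "x * conjugate w + conjugate (x * conjugate w) = of_int t"
    using trace_integers[OF xw] .
  have c: "conjugate (x + of_int k * w) = conjugate x + of_int k * conjugate w"
    using conj_diff[of x "- (of_int k * w)"] conj_diff[of 0 "of_int k * w"] x w conj_of_int[of 0]
    by (simp add: integers_fieldD fld.mem_intros conj_mult conj_of_int)
  have "(x + of_int k * w) * conjugate (x + of_int k * w) = x * conjugate x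
      + of_int k * (x * conjugate w + conjugate (x * conjugate w)) + of_int (k * k) * (w * conjugate w)"
    unfolding c using x w
    by (simp add: conj_mult conj_conj integers_fieldD conj_mem_field algebra_simps)
  then have "N (x + of_int k * w) = N x + k * t + k * k * N w"
    using x w by (intro N_eqI) (auto simp: t mult_conjugate_N intro!: ints.mem_intros)
  then show ?thesis by simp
qed

text \<open>Positivity of the norm form bounds the trace by \<open>2\<close> in absolute value, and
  the five quadratic equations left have only roots of unity as solutions.\<close>

lemma N_eq_1_imp_root_of_unity:
  assumes x: "x \<in> integers" and N: "N x = 1"
  shows "\<exists>n>0. x ^ n = 1"
proof -
  obtain t where t: "x + conjugate x = of_int t" using trace_integers[OF x] .
  have xx: "x * x = of_int t * x - 1"
    using mult_conjugate_N[OF x] N by (simp add: algebra_simps flip: t)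
  obtain r s where rs: "x = of_rat r + of_rat s * \<theta>" using integers_fieldD[OF x] by (elim field_setE)
  have "of_rat (2 * r) = (of_rat (of_int t) :: 'a)"
    using t unfolding rs conj_coord by (simp add: of_rat_mult)
  then have r: "2 * r = of_int t" by (simp only: of_rat_eq_iff)
  have "r * r + of_nat m * (s * s) = 1" using of_int_N[OF x] N unfolding rs nm_coord by simp
  moreover have "of_nat m * (s * s) \<ge> 0" by simp
  ultimately have "(2 * r) * (2 * r) \<le> 4" by linarith
  then have "(of_int (t * t) :: rat) \<le> of_int 4" by (simp add: r)
  then have "t * t \<le> 4" by (simp only: of_int_le_iff)
  then have "\<bar>t\<bar> \<le> 2" using abs_le_square_iff[of t 2] by (simp add: power2_eq_square)
  then consider "t = -2" | "t = -1" | "t = 0" | "t = 1" | "t = 2" by linarith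
  then show ?thesis
  proof cases
    case 1
    have "(x + 1) * (x + 1) = x * x + 2 * x + 1" by (simp add: algebra_simps)
    then have "(x + 1) * (x + 1) = 0" using xx 1 by simp
    then have "x = - 1" by (simp add: eq_neg_iff_add_eq_0)
    then show ?thesis by (intro exI[of _ 2]) simp
  next
    case 2
    then have h: "x * x = - x - 1" using xx by simp
    have "x ^ 3 = x * (x * x)" by (simp add: power3_eq_cube)
    also have "\<dots> = - (x * x) - x" by (subst h) (simp add: algebra_simps)
    also have "\<dots> = 1" unfolding h by simp
    finally have "x ^ 3 = 1" .
    then show ?thesis by (intro exI[of _ 3]) simp
  next
    case 3
    then have "x * x = - 1" using xx by simp
    then have "(x * x) * (x * x) = 1" by simp
    then show ?thesis by (intro exI[of _ 4]) (simp add: power4_eq_xxxx mult.assoc)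
  next
    case 4
    then have h: "x * x = x - 1" using xx by simp
    have "x * x * x = x * x - x" by (subst h) (simp add: algebra_simps)
    also have "\<dots> = - 1" unfolding h by simp
    finally have "x * x * x = - 1" .
    then have "(x * x * x) * (x * x * x) = 1" by simp
    then show ?thesis by (intro exI[of _ 6]) (simp add: numeral_eq_Suc mult.assoc)
  next
    case 5
    have "(x - 1) * (x - 1) = x * x - 2 * x + 1" by (simp add: algebra_simps)
    then have "(x - 1) * (x - 1) = 0" using xx 5 by simp
    then have "x = 1" by simp
    then show ?thesis by (intro exI[of _ 1]) simp
  qed
qed

lemma order_subset_integers: "quadratic_order \<theta> \<subseteq> integers"
  unfolding integers_def by (auto intro!: exI[of _ 1] order.power_mem)

text \<open>Carries the Frobenius from the order to all integers: multiply by a denominator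
  \<open>c\<close> prime to \<open>q\<close>, then cancel \<open>c\<close> by Bezout. In the
  applications \<open>e\<close> is \<open>1\<close> and \<open>y\<close> is \<open>x\<close>, or
  \<open>e\<close> is \<open>-1\<close> and \<open>y\<close> is its conjugate.\<close>

lemma frobenius_integers:
  fixes e :: int
  assumes q: "prime q" "odd q" and x: "x \<in> integers"
    and c: "c > 0" "of_nat c * x = of_int a + of_int b * \<theta>" "\<not> q dvd c"
    and e: "int q dvd (- int m) ^ ((q - 1) div 2) - e"
    and y: "y \<in> integers" "of_nat c * y = of_int a + of_int (b * e) * \<theta>"
  shows "\<exists>z\<in>integers. x ^ q = y + of_nat q * z"
proof -
  have \<theta>S: "\<theta> \<in> integers"
    using order_subset_integers unfolding quadratic_order_def by (force intro: exI[of _ 0] exI[of _ 1])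
  obtain z where z: "z \<in> integers"
    "(of_int a + of_int b * \<theta>) ^ q = of_int a + of_int (b * (- int m) ^ ((q - 1) div 2)) * \<theta> + of_nat q * z"
    using frobenius_quadratic_order[OF theta_square' q, of a b] order_subset_integers by blast
  obtain l where l: "(- int m) ^ ((q - 1) div 2) = e + int q * l"
    using e by (metis dvd_def add.commute diff_add_cancel)
  obtain k where k: "int c ^ q = int c + int q * k"
    using fermat_little_int[OF q, of "int c"] by (metis dvd_def add.commute diff_add_cancel)
  define z2 where "z2 = z + of_int (b * l) * \<theta> - of_int k * x ^ q"
  have z2S: "z2 \<in> integers" unfolding z2_def using z(1) x \<theta>S by (intro ints.mem_intros)
  have "of_int (int c ^ q) * x ^ q = (of_nat c * x) ^ q" by (simp add: power_mult_distrib)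
  also have "\<dots> = of_nat c * y + of_nat q * (z + of_int (b * l) * \<theta>)"
    unfolding c(2) y(2) z(2) l by (simp add: algebra_simps)
  finally have cz: "of_nat c * (x ^ q - y) = of_nat q * z2"
    unfolding k z2_def by (simp add: algebra_simps)
  have "coprime (int c) (int q)" using prime_imp_coprime[of q c] q(1) c(3) by (simp add: coprime_commute)
  then obtain u v where uv: "u * int c + v * int q = 1" by (metis coprime_iff_gcd_eq_1 bezout_int)
  have "x ^ q - y = of_int (u * int c + v * int q) * (x ^ q - y)" by (simp add: uv)
  also have "\<dots> = of_int u * (of_nat c * (x ^ q - y)) + of_nat q * (of_int v * (x ^ q - y))"
    by (simp add: algebra_simps)
  also have "\<dots> = of_nat q * (of_int u * z2 + of_int v * (x ^ q - y))"
    unfolding cz by (simp add: algebra_simps)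
  finally have "x ^ q = y + of_nat q * (of_int u * z2 + of_int v * (x ^ q - y))" by (simp add: algebra_simps)
  then show ?thesis using z2S x y(1)
    by (intro bexI[of _ "of_int u * z2 + of_int v * (x ^ q - y)"]) (auto intro!: ints.mem_intros)
qed

lemma integers_coord:
  assumes "x \<in> integers"
  obtains c :: nat and a b :: int where "c > 0" "of_nat c * x = of_int a + of_int b * \<theta>"
    "of_nat c * conjugate x = of_int a - of_int b * \<theta>"
proof -
  obtain c :: nat where c: "c > 0" "of_nat c * x \<in> quadratic_order \<theta>"
    using ex_denominator[OF integers_fieldD[OF assms]] .
  then obtain a b where ab: "of_nat c * x = of_int a + of_int b * \<theta>" unfolding quadratic_order_def by blast
  have "of_nat c * conjugate x = conjugate (of_nat c * x)"
    using assms by (simp add: conj_mult conj_of_nat fld.of_nat_mem integers_fieldD)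
  also have "\<dots> = of_int a - of_int b * \<theta>" unfolding ab using conj_coord[of "of_int a" "of_int b"] by simp
  finally show ?thesis by (rule that[OF c(1) ab])
qed

text \<open>Clearing the denominator multiplies the norm by \<open>c * c\<close>, which keeps the
  parity of the multiplicity.\<close>

lemma even_multiplicity_N:
  assumes p: "prime p" "odd p" and nonres: "int p dvd (- int m) ^ ((p - 1) div 2) + 1"
    and x: "x \<in> integers" "x \<noteq> 0"
  shows "even (multiplicity (int p) (N x))"
proof -
  obtain c a b where c: "c > 0" "of_nat c * x = of_int a + of_int b * \<theta>"
    using integers_coord[OF x(1)] by blast
  have "nm (of_nat c * x) = of_int (int c * int c * N x)"
    using x(1) by (simp add: nm_mult fld.of_nat_mem integers_fieldD nm_of_nat of_int_N)
  moreover have "nm (of_nat c * x) = of_int (a\<^sup>2 + int m * b\<^sup>2)"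
    unfolding c(2) using nm_coord[of "of_int a" "of_int b"] by (simp add: power2_eq_square)
  ultimately have eq: "int c * int c * N x = a\<^sup>2 + int m * b\<^sup>2" by (simp only: of_int_eq_iff)
  have N0: "N x \<noteq> 0" using N_pos[OF x] by simp
  have "even (multiplicity (int p) (int c * int c * N x))"
    unfolding eq by (rule even_multiplicity_norm_form[OF p nonres]) (use eq c N0 in auto)
  then show ?thesis using p c N0 by (simp add: prime_elem_multiplicity_mult_distrib)
qed

text \<open>All powers of \<open>x\<close> lie in the integer span of \<open>1\<close> and
  \<open>x\<close>, which is finite modulo \<open>W\<close>, so they are eventually
  periodic.\<close>

lemma ex_idempotent_power:
  assumes x: "x \<in> integers" and W: "W > 0"
  obtains n where "n > 0" "\<exists>z\<in>integers. x ^ n * (x ^ n - 1) = of_int W * z"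
proof -
  obtain t where t: "x + conjugate x = of_int t" using trace_integers[OF x] .
  have xx: "x * x = of_int t * x - of_int (N x)"
    using mult_conjugate_N[OF x] by (simp add: algebra_simps flip: t)
  have "\<exists>a b. x ^ k = of_int a + of_int b * x" for k
  proof (induction k)
    case (Suc k)
    then obtain a b where "x ^ k = of_int a + of_int b * x" by blast
    then have "x ^ Suc k = of_int a * x + of_int b * (x * x)" by (simp add: algebra_simps)
    also have "\<dots> = of_int (- b * N x) + of_int (a + b * t) * x" unfolding xx by (simp add: algebra_simps)
    finally show ?case by blast
  qed (auto intro: exI[of _ 1] exI[of _ 0])
  then obtain a b where ab: "\<And>k. x ^ k = of_int (a k) + of_int (b k) * x" by metis
  let ?f = "\<lambda>k. (a k mod W, b k mod W)"
  have "range ?f \<subseteq> {0..<W} \<times> {0..<W}" using W by auto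
  then have "finite (range ?f)" by (rule finite_subset) auto
  then have "\<not> inj ?f" using finite_imageD by blast
  then obtain i j where ij: "i < j" "?f i = ?f j" unfolding inj_def by (metis linorder_neqE_nat)
  then obtain k l where kl: "a j = a i + W * k" "b j = b i + W * l"
    by (metis (no_types, opaque_lifting) Pair_inject mod_eqE)
  have xij: "x ^ j - x ^ i = of_int W * (of_int k + of_int l * x)"
    unfolding ab[of i] ab[of j] kl by (simp add: algebra_simps)
  define d where "d = j - i"
  \<comment> \<open>A multiple of the period \<open>d\<close> that is past the preperiod
    \<open>i\<close>.\<close>
  define n where "n = d * Suc i"
  interpret I: ideal_set integers "{of_int W * z | z. z \<in> integers}"
    by (rule ints.principal_ideal_set[OF ints.of_int_mem])
  have "x ^ i * (x ^ d - 1) \<in> {of_int W * z | z. z \<in> integers}"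
  proof -
    have "x ^ i * (x ^ d - 1) = x ^ j - x ^ i"
      using ij(1) by (simp add: d_def algebra_simps flip: power_add)
    then show ?thesis using xij x by (auto intro!: exI ints.mem_intros)
  qed
  moreover have "x ^ n - 1 = (x ^ d - 1) * (\<Sum>k<Suc i. (x ^ d) ^ k)"
    unfolding n_def power_mult by (rule power_diff_1_eq)
  moreover have "i \<le> n" using ij(1) unfolding n_def d_def by (cases "j - i") auto
  then have "x ^ n = x ^ i * x ^ (n - i)" by (simp flip: power_add)
  ultimately have "x ^ n * (x ^ n - 1) = (x ^ (n - i) * (\<Sum>k<Suc i. (x ^ d) ^ k)) * (x ^ i * (x ^ d - 1))"
    by (simp only: mult_ac)
  also have "\<dots> \<in> {of_int W * z | z. z \<in> integers}"
    by (rule I.ideal_mult) (use x \<open>x ^ i * (x ^ d - 1) \<in> _\<close> in \<open>auto intro!: ints.mem_intros\<close>)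
  finally show ?thesis using that[of n] ij(1) by (auto simp: n_def d_def)
qed

end

section \<open>Prime factors of norms and orders of residues\<close>

lemma dvd_prod_minus_one:
  fixes f :: "'b \<Rightarrow> int"
  assumes "\<And>x. x \<in> A \<Longrightarrow> k dvd f x - 1"
  shows "k dvd prod f A - 1"
  using assms
proof (induction A rule: infinite_finite_induct)
  case (insert x A)
  have "prod f (insert x A) - 1 = (f x - 1) * prod f A + (prod f A - 1)"
    using insert by (simp add: algebra_simps)
  also have "k dvd \<dots>" using insert by (intro dvd_add dvd_mult2) auto
  finally show ?case .
qed auto

text \<open>Whole prime powers are considered because for an inert prime only its even powers will
  be known to be \<open>1\<close> modulo \<open>q\<close>.\<close>

lemma dvd_minus_one_of_prime_powers:
  assumes "n > 0" "\<And>p. prime p \<Longrightarrow> p dvd n \<Longrightarrow> int q dvd int p ^ multiplicity p n - 1"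
  shows "int q dvd int n - 1"
proof -
  have "(\<Prod>p\<in>prime_factors n. p ^ multiplicity p n) = n"
    using assms(1) prod_prime_factors[of n] by simp
  then have "int n = (\<Prod>p\<in>prime_factors n. int p ^ multiplicity p n)"
    by (metis (no_types, lifting) of_nat_power of_nat_prod prod.cong)
  also have "int q dvd \<dots> - 1"
    by (rule dvd_prod_minus_one) (use assms in \<open>auto simp: in_prime_factors_iff\<close>)
  finally show ?thesis .
qed

text \<open>Otherwise \<open>gcd a (z * t) * p\<close> would be a common divisor of \<open>a\<close>
  and \<open>z * t\<close>. The lemma makes the cofactor of the gcd prime to
  \<open>z\<close>.\<close>

lemma gcd_cofactor_coprime:
  fixes a t z p :: int
  assumes "a > 0" and d: "gcd a (z * t) dvd t"
    and p: "p dvd z" "p dvd a div gcd a (z * t)"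
  shows "p dvd 1"
proof -
  let ?d = "gcd a (z * t)"
  have d0: "?d > 0" using assms(1) by simp
  have "?d * p dvd ?d * (a div ?d)" using p(2) by (rule mult_dvd_mono[OF dvd_refl])
  then have "?d * p dvd a" by simp
  moreover have "?d * p dvd z * t" using mult_dvd_mono[OF d p(1)] by (simp add: mult.commute)
  ultimately have "?d * p dvd ?d * 1" using gcd_greatest by simp
  then show ?thesis using d0 by (simp only: dvd_times_left_cancel_iff)
qed

context imaginary_quadratic
begin

text \<open>The ideal generated by \<open>p\<close> and \<open>g\<close> is proper: if
  \<open>1 = p * z + g * r\<close>, then \<open>N (g * r)\<close> is \<open>1\<close> modulo
  \<open>p\<close>, yet it is a multiple of \<open>N g\<close>.\<close>

lemma ex_prime_ideal_over_norm_divisor: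
  assumes g: "g \<in> integers" and p: "prime p" "int p dvd N g"
  obtains P where "prime_ideal_set integers P" "of_nat p \<in> P" "g \<in> P"
proof -
  let ?I = "{of_nat p * z | z. z \<in> integers}"
  interpret I: ideal_set integers ?I
    by (rule ints.principal_ideal_set[OF ints.of_nat_mem])
  let ?J = "{a + g * r | a r. a \<in> ?I \<and> r \<in> integers}"
  interpret J: ideal_set integers ?J by (rule I.ideal_extend[OF g])
  have "1 \<notin> ?J"
  proof
    assume "1 \<in> ?J"
    then obtain z r where zr: "1 = of_nat p * z + g * r" "z \<in> integers" "r \<in> integers" by blast
    have "int p dvd N (g * r + of_int (int p) * z) - N (g * r)"
      using zr g by (intro N_cong ints.mult_mem)
    also have "g * r + of_int (int p) * z = 1" using zr(1) by (simp add: algebra_simps)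
    finally have "int p dvd 1 - N g * N r" using g zr by (simp add: N_one N_mult)
    moreover have "int p dvd N g * N r" using p(2) by simp
    ultimately have "int p dvd 1" by (metis dvd_add_right_iff diff_add_cancel add.commute)
    then show False using p(1) by auto
  qed
  then obtain P where P: "prime_ideal_set integers P" "?J \<subseteq> P" using J.ex_prime_ideal by blast
  have "of_nat p * 1 + g * 0 \<in> ?J" "of_nat p * 0 + g * 1 \<in> ?J"
    using ints.one_mem ints.zero_mem by blast+
  then show ?thesis using that[OF P(1)] P(2) by auto
qed

text \<open>The two congruences say that \<open>p\<close> splits, respectively that \<open>p\<close> is inert.\<close>

lemma residue_order_dvd:
  assumes P: "prime_ideal_set integers P" and p: "prime p" "odd p" "of_nat p \<in> P"
    and x: "x \<in> integers" "x \<notin> P" and c: "c > 0" "of_nat c * x = of_int a + of_int b * \<theta>"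
    "of_nat c * conjugate x = of_int a - of_int b * \<theta>" "\<not> p dvd c"
  shows "int p dvd (- int m) ^ ((p - 1) div 2) - 1 \<Longrightarrow> x ^ (p - 1) - 1 \<in> P"
    and "int p dvd (- int m) ^ ((p - 1) div 2) + 1 \<Longrightarrow> x ^ (p\<^sup>2 - 1) - 1 \<in> P"
proof -
  interpret P: prime_ideal_set integers P by (rule P)
  have cx: "conjugate x \<in> integers" using x(1) by (rule conj_mem_integers)
  have step: "x ^ (k - 1) - 1 \<in> P" if k: "x ^ k - x \<in> P" "k > 0" for k
  proof -
    have "x * (x ^ (k - 1) - 1) \<in> P" using k by (simp add: algebra_simps flip: power_Suc)
    then show ?thesis using P.prime_ideal[of x "x ^ (k - 1) - 1"] x by (auto intro: ints.mem_intros)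
  qed
  have pz: "of_nat p * z \<in> P" if "z \<in> integers" for z using P.ideal_mult'[OF p(3) that] .
  {
    assume "int p dvd (- int m) ^ ((p - 1) div 2) - 1"
    then obtain z where z: "z \<in> integers" "x ^ p = x + of_nat p * z"
      using frobenius_integers[OF p(1,2) x(1) c(1,2,4), of 1 x] x(1) c(2) by auto
    have "x ^ p - x \<in> P" using z pz[OF z(1)] by simp
    then show "x ^ (p - 1) - 1 \<in> P" using step p(1) prime_gt_0_nat by blast
  }
  assume "int p dvd (- int m) ^ ((p - 1) div 2) + 1"
  then obtain z where z: "z \<in> integers" "x ^ p = conjugate x + of_nat p * z"
    using frobenius_integers[OF p(1,2) x(1) c(1,2,4), of "-1" "conjugate x"] cx c(3) by auto
  have A: "x ^ p - conjugate x \<in> P" using z pz[OF z(1)] by simp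
  have zc: "conjugate z \<in> integers" by (rule conj_mem_integers[OF z(1)])
  \<comment> \<open>Conjugating the exact identity keeps the error a multiple of \<open>p\<close>,
    hence in \<open>P\<close>.\<close>
  have "conjugate x ^ p = conjugate (x ^ p)" using x(1) by (simp add: conj_power integers_fieldD)
  also have "\<dots> = conjugate (conjugate x - (- (of_nat p * z)))" unfolding z(2) by simp
  also have "\<dots> = x - conjugate (- (of_nat p * z))"
    using x(1) z(1) by (subst conj_diff) (auto simp: conj_conj integers_fieldD conj_mem_field intro!: fld.mem_intros)
  also have "- (of_nat p * z) = of_int (- int p) * z" by simp
  also have "conjugate (of_int (- int p) * z) = of_int (- int p) * conjugate z"
    using z(1) by (simp only: conj_mult[OF fld.of_int_mem] integers_fieldD conj_of_int)
  finally have "conjugate x ^ p - x \<in> P" using pz[OF zc] by simp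
  moreover have "(x ^ p) ^ p - conjugate x ^ p \<in> P"
    by (rule P.cong_power[OF A]) (use x cx in \<open>auto intro: ints.mem_intros\<close>)
  ultimately have "(x ^ p) ^ p - x \<in> P" using P.cong_trans by blast
  then have "x ^ p\<^sup>2 - x \<in> P" by (simp add: power2_eq_square power_mult)
  then show "x ^ (p\<^sup>2 - 1) - 1 \<in> P" using step[of "p\<^sup>2"] p(1) prime_gt_0_nat by simp
qed

end

lemma multiplicity_int_of_nat:
  assumes "prime p" "n > 0"
  shows "multiplicity (int p) (int n) = multiplicity p n"
proof (rule multiplicity_eqI)
  have dvd: "int p ^ k dvd int n \<longleftrightarrow> p ^ k dvd n" for k
    by (simp only: int_dvd_int_iff flip: of_nat_power)
  have "\<not> is_unit p" "n \<noteq> 0" using assms by auto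
  then have "p ^ k dvd n \<longleftrightarrow> k \<le> multiplicity p n" for k
    by (simp add: power_dvd_iff_le_multiplicity)
  then show "int p ^ multiplicity p n dvd int n" "\<not> int p ^ Suc (multiplicity p n) dvd int n"
    unfolding dvd by (simp_all del: power_Suc)
qed

section \<open>Contradiction from finitely many prime ideals\<close>

context imaginary_quadratic
begin

text \<open>The conclusion makes the two residue subgroups equal: modulo \<open>P\<close>,
  \<open>\<beta>\<close> is the \<open>q\<close>-th power of \<open>\<alpha>\<close>, with
  \<open>q\<close> prime to an exponent \<open>e\<close> that kills \<open>\<alpha>\<close>.
  \<open>G\<close> collects the prime ideals to be avoided.\<close>

theorem ex_prime_ideal_coprime_exponents:
  assumes \<alpha>: "\<alpha> \<in> integers" "\<alpha> \<noteq> 0" "N \<alpha> \<noteq> 1" and \<beta>: "\<beta> \<in> integers" "\<beta> \<noteq> 0" "N \<beta> \<noteq> 1"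
    and G: "finite G" "\<And>P. P \<in> G \<Longrightarrow> \<exists>n>0. of_nat n \<in> P"
  shows "\<exists>P q e. prime_ideal_set integers P \<and> P \<notin> G \<and> (\<exists>n>0. of_nat n \<in> P) \<and> \<alpha> \<notin> P \<and> \<beta> \<notin> P \<and>
    \<alpha> ^ q - \<beta> \<in> P \<and> e > 0 \<and> \<alpha> ^ e - 1 \<in> P \<and> coprime q e"
proof (rule ccontr)
  assume none: "\<not> ?thesis"
  have N\<alpha>: "N \<alpha> \<ge> 2" and N\<beta>: "N \<beta> \<ge> 2" using N_pos[of \<alpha>] N_pos[of \<beta>] \<alpha> \<beta> by auto
  define \<delta> where "\<delta> = 1 - \<alpha> * \<beta>"
  have \<delta>S: "\<delta> \<in> integers" unfolding \<delta>_def using \<alpha> \<beta> by (intro ints.mem_intros)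
  have "N (\<alpha> * \<beta>) > 1" using N_mult[OF \<alpha>(1) \<beta>(1)] N\<alpha> N\<beta> less_1_mult[of "N \<alpha>" "N \<beta>"] by simp
  then have "\<alpha> * \<beta> \<noteq> 1" using N_one by auto
  then have \<delta>0: "\<delta> \<noteq> 0" by (simp add: \<delta>_def)
  have N\<delta>: "N \<delta> > 0" by (rule N_pos[OF \<delta>S \<delta>0])
  obtain c a b where c: "c > 0" "of_nat c * \<alpha> = of_int a + of_int b * \<theta>"
    "of_nat c * conjugate \<alpha> = of_int a - of_int b * \<theta>"
    using integers_coord[OF \<alpha>(1)] .
  obtain n where n: "\<And>P. P \<in> G \<Longrightarrow> n P > 0 \<and> of_nat (n P) \<in> P" using G(2) by metis
  \<comment> \<open>A prime ideal in \<open>G\<close> can only lie above a prime divisor of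
    \<open>nG\<close>.\<close>
  define nG where "nG = (\<Prod>P\<in>G. n P)"
  have nG: "nG > 0" using n unfolding nG_def by (intro prod_pos) auto
  \<comment> \<open>The norm of \<open>\<beta> * \<delta>\<close>; it will bound \<open>D\<close>
    independently of \<open>q\<close>.\<close>
  define T where "T = N \<beta> * N \<delta>"
  have T: "T > 0" unfolding T_def using N\<beta> N\<delta> by simp
  \<comment> \<open>A prime that does not divide \<open>Z\<close> is odd, prime to \<open>m\<close>,
    to the denominator \<open>c\<close> and to the norms involved, and no ideal above it is in
    \<open>G\<close>.\<close>
  define Z where "Z = 2 * int m * N \<alpha> * N \<beta> * N \<delta> * int c * int nG"
  have Z: "Z > 0" unfolding Z_def using m_pos N\<alpha> N\<beta> N\<delta> c(1) nG by simp
  \<comment> \<open>The extra factor \<open>T\<close> ensures that, once \<open>D\<close> divides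
    \<open>T\<close>, the cofactor of \<open>D\<close> in \<open>N g\<close> is prime to
    \<open>Z\<close>.\<close>
  define W where "W = Z * T"
  have W: "W > 0" unfolding W_def using Z T by simp
  obtain M where M: "M > 0" "\<exists>z\<in>integers. \<alpha> ^ M * (\<alpha> ^ M - 1) = of_int W * z"
    using ex_idempotent_power[OF \<alpha>(1) W] .
  obtain z where z: "z \<in> integers" "\<alpha> ^ M * (\<alpha> ^ M - 1) = of_int W * z" using M(2) ..
  \<comment> \<open>So that \<open>q\<close> exceeds the bound for \<open>D\<close>, does not divide
    \<open>c\<close>, and makes \<open>g\<close> nonzero.\<close>
  define B where "B = nat T + c + nat (N \<beta>)"
  \<comment> \<open>The factor \<open>3\<close> makes the modulus large enough even if
    \<open>M\<close> is \<open>1\<close>, and yields \<open>M \<le> q\<close>.\<close>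
  obtain q where q: "prime q" "odd q" "q > B" "3 * M dvd q + 1"
      "int q dvd (- int m) ^ ((q - 1) div 2) + 1"
    using ex_inert_prime_minus_one_mod[OF m_pos, of "3 * M" B] M(1) by auto
  have qT: "T < int q" and qc: "c < q" and q\<beta>: "N \<beta> < int q" using q(3) unfolding B_def by linarith+
  obtain k where k: "q + 1 = M * k" using q(4) by (metis dvd_def dvd_mult_left mult.commute)
  have qM: "M \<le> q"
  proof -
    have "3 * M \<le> q + 1" using q(4) by (intro dvd_imp_le) auto
    then show ?thesis using M(1) by linarith
  qed
  have pow_1: "\<alpha> ^ (q + 1) - 1 = (\<alpha> ^ M - 1) * (\<Sum>i<k. (\<alpha> ^ M) ^ i)"
    unfolding k power_mult by (rule power_diff_1_eq)
  have sumS: "(\<Sum>i<k. (\<alpha> ^ M) ^ i) \<in> integers" using \<alpha> by (intro ints.mem_intros)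
  define g where "g = \<alpha> ^ q - \<beta>"
  have gS: "g \<in> integers" unfolding g_def using \<alpha> \<beta> by (intro ints.mem_intros)
  have g0: "g \<noteq> 0"
  proof
    assume "g = 0"
    then have "N \<beta> = N \<alpha> ^ q" using N_power[OF \<alpha>(1), of q] by (simp add: g_def)
    moreover have "(2::int) ^ q \<le> N \<alpha> ^ q" using N\<alpha> by (intro power_mono) auto
    moreover have "int q < 2 ^ q" using less_exp[of q] by (metis of_nat_less_iff of_nat_numeral of_nat_power)
    ultimately show False using q\<beta> by linarith
  qed
  have Ng: "N g > 0" by (rule N_pos[OF gS g0])

  \<comment> \<open>Modulo \<open>\<delta>\<close> the inverse of \<open>\<alpha>\<close> is
    \<open>\<beta>\<close>. An invertible idempotent is \<open>1\<close>, so
    \<open>\<alpha> ^ M\<close>, hence \<open>\<alpha> ^ (q + 1)\<close>, is \<open>1\<close> and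
    \<open>\<alpha> ^ q\<close> is \<open>\<beta>\<close>; thus \<open>\<delta>\<close> divides
    \<open>g\<close>.\<close>
  have \<delta>_dvd: "N \<delta> dvd N g"
  proof -
    let ?I = "{\<delta> * z | z. z \<in> integers}"
    interpret I: ideal_set integers ?I by (rule ints.principal_ideal_set[OF \<delta>S])
    have \<delta>I: "\<delta> \<in> ?I" using ints.one_mem by force
    have WI: "of_int W \<in> ?I"
    proof -
      have "of_int W = of_int (Z * N \<beta>) * (\<delta> * conjugate \<delta>)"
        unfolding mult_conjugate_N[OF \<delta>S] by (simp add: W_def T_def)
      also have "\<dots> = \<delta> * (of_int (Z * N \<beta>) * conjugate \<delta>)" by (simp only: mult_ac)
      finally show ?thesis using \<delta>S by (auto intro!: exI ints.mult_mem ints.of_int_mem conj_mem_integers simp del: of_int_mult)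
    qed
    have "\<alpha> * \<beta> - 1 \<in> ?I" using I.ideal_uminus[OF \<delta>I] by (simp add: \<delta>_def)
    then have "(\<alpha> * \<beta>) ^ M - 1 ^ M \<in> ?I" using \<alpha> \<beta> by (intro I.cong_power ints.mem_intros)
    then have "- (((\<alpha> * \<beta>) ^ M - 1) * (\<alpha> ^ M - 1)) + \<beta> ^ M * z * of_int W \<in> ?I"
      using \<alpha> \<beta> z(1) WI by (intro I.ideal_add[OF I.ideal_uminus[OF I.ideal_mult'] I.ideal_mult] ints.mem_intros) auto
    also have "\<beta> ^ M * z * of_int W = \<beta> ^ M * (\<alpha> ^ M * (\<alpha> ^ M - 1))" unfolding z(2) by (simp only: mult_ac)
    also have "- (((\<alpha> * \<beta>) ^ M - 1) * (\<alpha> ^ M - 1)) + \<beta> ^ M * (\<alpha> ^ M * (\<alpha> ^ M - 1)) = \<alpha> ^ M - 1"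
      by (simp add: power_mult_distrib algebra_simps)
    finally have "\<alpha> ^ (q + 1) - 1 \<in> ?I" unfolding pow_1 by (rule I.ideal_mult'[OF _ sumS])
    then have "\<alpha> ^ q * \<delta> + \<beta> * (\<alpha> ^ (q + 1) - 1) \<in> ?I"
      using \<alpha> \<beta> \<delta>I by (intro I.ideal_add[OF I.ideal_mult I.ideal_mult] ints.mem_intros)
    also have "\<alpha> ^ q * \<delta> + \<beta> * (\<alpha> ^ (q + 1) - 1) = g" by (simp add: g_def \<delta>_def algebra_simps)
    finally obtain y where "y \<in> integers" "g = \<delta> * y" by blast
    then show ?thesis using \<delta>S by (simp add: N_mult)
  qed

  define D where "D = gcd (N g) W"
  have D: "D > 0" unfolding D_def using W by simp
  \<comment> \<open>\<open>\<alpha> ^ q * (\<alpha> ^ (q + 1) - 1)\<close> is a multiple of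
    \<open>W\<close>, so \<open>\<beta> * \<delta>\<close>, of norm \<open>T\<close>, is a multiple
    of \<open>g\<close> modulo \<open>W\<close>.\<close>
  have D_T: "D dvd T"
  proof -
    define y where "y = \<alpha> ^ (q - M) * z * - (\<Sum>i<k. (\<alpha> ^ M) ^ i)"
    define x where "x = \<alpha> ^ (q + 1) - \<delta>"
    have xS: "x \<in> integers" and yS: "y \<in> integers"
      unfolding x_def y_def using \<alpha> \<delta>S z(1) sumS by (auto intro!: ints.mem_intros)
    have aq: "\<alpha> ^ q = \<alpha> ^ (q - M) * \<alpha> ^ M" using qM by (simp flip: power_add)
    have "\<alpha> ^ q * (\<alpha> ^ (q + 1) - 1) = \<alpha> ^ (q - M) * (\<alpha> ^ M * (\<alpha> ^ M - 1)) * (\<Sum>i<k. (\<alpha> ^ M) ^ i)"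
      unfolding pow_1 aq by (simp only: mult_ac)
    then have "\<alpha> ^ q * (\<alpha> ^ (q + 1) - 1) = - (of_int W * y)" unfolding z(2) y_def by (simp add: mult_ac)
    moreover have "\<beta> * \<delta> = x * g - \<alpha> ^ q * (\<alpha> ^ (q + 1) - 1)"
      unfolding x_def g_def \<delta>_def by (simp add: algebra_simps)
    ultimately have eq: "\<beta> * \<delta> = x * g + of_int W * y" by simp
    have "W dvd N (\<beta> * \<delta>) - N (x * g)" unfolding eq using xS yS gS by (intro N_cong ints.mult_mem)
    then have "W dvd T - N x * N g" using \<beta> \<delta>S xS gS by (simp add: N_mult T_def)
    then have "D dvd T - N x * N g" unfolding D_def by (meson gcd_dvd2 dvd_trans)
    moreover have "D dvd N x * N g" unfolding D_def by simp
    ultimately show ?thesis by (metis dvd_add_right_iff diff_add_cancel add.commute)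
  qed
  have \<delta>_D: "N \<delta> dvd D" unfolding D_def by (rule gcd_greatest[OF \<delta>_dvd]) (simp add: W_def T_def)
  define R where "R = nat (N g div D)"
  have DR: "N g = D * int R" and R: "R > 0"
  proof -
    have "D dvd N g" by (simp add: D_def)
    then have "N g div D > 0" using Ng D by (simp add: pos_imp_zdiv_pos_iff zdvd_imp_le)
    then show "N g = D * int R" "R > 0" using \<open>D dvd N g\<close> by (auto simp: R_def)
  qed

  \<comment> \<open>By \<open>none\<close>, \<open>q\<close> divides every positive exponent that
    kills \<open>\<alpha>\<close> modulo a prime ideal above \<open>p\<close> containing
    \<open>g\<close>; \<open>p - 1\<close> or \<open>p\<^sup>2 - 1\<close> is such an
    exponent.\<close>
  have prime_power: "int q dvd int p ^ multiplicity p R - 1" if p: "prime p" "p dvd R" for p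
  proof -
    have "int p dvd int R" using p(2) by simp
    have pZ: "\<not> int p dvd Z"
    proof
      assume "int p dvd Z"
      moreover have "int p dvd N g div gcd (N g) (Z * T)" using \<open>int p dvd int R\<close> DR D
        unfolding D_def W_def by (metis nonzero_mult_div_cancel_left less_irrefl)
      ultimately have "int p dvd 1"
        using gcd_cofactor_coprime[OF Ng] D_T unfolding D_def W_def by blast
      then show False using p(1) by auto
    qed
    have np: "\<not> int p dvd 2" "\<not> int p dvd int m" "\<not> int p dvd N \<alpha>" "\<not> int p dvd N \<beta>" "\<not> int p dvd N \<delta>"
        "\<not> p dvd c" "\<not> p dvd nG"
      using pZ by (auto simp: Z_def)
    have odd: "odd p" using np(1) primes_dvd_imp_eq[of 2 p] p(1) by auto
    have "int p dvd N g" using \<open>int p dvd int R\<close> DR by simp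
    then obtain P where P: "prime_ideal_set integers P" "of_nat p \<in> P" "g \<in> P"
      using ex_prime_ideal_over_norm_divisor[OF gS p(1)] by blast
    interpret P: prime_ideal_set integers P by (rule P(1))
    \<comment> \<open>The norm is a multiple of the element, so elements of \<open>P\<close> have
      norm divisible by \<open>p\<close>.\<close>
    have notin: "x \<notin> P" if "x \<in> integers" "\<not> int p dvd N x" for x
    proof
      assume "x \<in> P"
      then have "x * conjugate x \<in> P" using that by (intro P.ideal_mult' conj_mem_integers)
      then have "of_int (N x) \<in> P" using that by (simp add: mult_conjugate_N)
      then show False using that P.of_int_mem_iff[OF p(1) P(2)] by blast
    qed
    have \<alpha>P: "\<alpha> \<notin> P" and \<beta>P: "\<beta> \<notin> P" using notin \<alpha> \<beta> np by blast+
    have "P \<notin> G"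
    proof
      assume "P \<in> G"
      then have "p dvd n P" using n P.of_nat_mem_iff[OF p(1) P(2)] by blast
      also have "n P dvd nG" unfolding nG_def using \<open>P \<in> G\<close> G(1) by (intro dvd_prodI)
      finally show False using np by blast
    qed
    moreover have "\<exists>n>0. of_nat n \<in> P" using P(2) prime_gt_0_nat[OF p(1)] by blast
    ultimately have old: "q dvd e" if "e > 0" "\<alpha> ^ e - 1 \<in> P" for e
      using none P(1,3) \<alpha>P \<beta>P that prime_imp_coprime[OF q(1), of e] unfolding g_def by blast
    note ord = residue_order_dvd[OF P(1) p(1) odd P(2) \<alpha>(1) \<alpha>P c np(6)]
    have p2: "p \<ge> 2" using p(1) by (rule prime_ge_2_nat)
    have "\<not> int p dvd - int m" using np(2) by simp
    then consider "int p dvd (- int m) ^ ((p - 1) div 2) - 1" | "int p dvd (- int m) ^ ((p - 1) div 2) + 1"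
      using euler_dichotomy[OF p(1) odd] by blast
    then show ?thesis
    proof cases
      case 1
      have "q dvd p - 1" using ord(1)[OF 1] p2 by (intro old) auto
      then have "int q dvd int (p - 1)" by (simp only: int_dvd_int_iff)
      then have "int q dvd int p - 1" using p2 by (simp add: of_nat_diff)
      also have "int p - 1 dvd int p ^ multiplicity p R - 1"
        unfolding power_diff_1_eq by simp
      finally show ?thesis .
    next
      case 2
      have "p\<^sup>2 > 1" using p2 by (intro one_less_power) auto
      then have "q dvd p\<^sup>2 - 1" using ord(2)[OF 2] by (intro old) auto
      then have "int q dvd int (p\<^sup>2 - 1)" by (simp only: int_dvd_int_iff)
      then have dvd: "int q dvd (int p)\<^sup>2 - 1" using \<open>p\<^sup>2 > 1\<close> by (simp add: of_nat_diff)
      have pD: "\<not> int p dvd D"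
      proof
        assume "int p dvd D"
        then have "int p dvd N \<beta> * N \<delta>" using D_T unfolding T_def by (rule dvd_trans)
        then show False using np p(1) by (simp add: prime_dvd_mult_iff)
      qed
      \<comment> \<open>As \<open>p\<close> is inert and prime to \<open>D\<close>, it occurs in
        \<open>R\<close> to the same even power as in \<open>N g\<close>.\<close>
      have "even (multiplicity (int p) (N g))" by (rule even_multiplicity_N[OF p(1) odd 2 gS g0])
      also have "multiplicity (int p) (N g) = multiplicity (int p) (int R)"
        unfolding DR using p(1) D R pD
        by (simp add: prime_elem_multiplicity_mult_distrib not_dvd_imp_multiplicity_0)
      also have "\<dots> = multiplicity p R" using p(1) R by (intro multiplicity_int_of_nat)
      finally obtain j where "multiplicity p R = 2 * j" by (elim evenE)
      then have "int p ^ multiplicity p R = ((int p)\<^sup>2) ^ j" by (simp add: power_mult)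
      moreover have "(int p)\<^sup>2 - 1 dvd ((int p)\<^sup>2) ^ j - 1" unfolding power_diff_1_eq[of "(int p)\<^sup>2" j] by simp
      ultimately show ?thesis using dvd by (metis dvd_trans)
    qed
  qed
  have qR: "int q dvd int R - 1" by (rule dvd_minus_one_of_prime_powers[OF R prime_power])
  have "int q dvd D * (int R - 1)" using qR by simp
  then have qND: "int q dvd N g - D" unfolding DR by (simp add: algebra_simps)

  \<comment> \<open>As \<open>q\<close> is inert, \<open>\<alpha> ^ q\<close> is the conjugate of
    \<open>\<alpha>\<close> modulo \<open>q\<close>, so \<open>h\<close> is \<open>g\<close> modulo
    \<open>q\<close>.\<close>
  define h where "h = conjugate \<alpha> - \<beta>"
  have hS: "h \<in> integers" unfolding h_def using \<alpha> \<beta> by (intro ints.diff_mem conj_mem_integers)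
  have "\<not> q dvd c" using qc c(1) by (meson dvd_imp_le not_le)
  then obtain y where y: "y \<in> integers" "\<alpha> ^ q = conjugate \<alpha> + of_nat q * y"
    using frobenius_integers[OF q(1,2) \<alpha>(1) c(1,2), of "-1" "conjugate \<alpha>"] q(5) c(3) conj_mem_integers[OF \<alpha>(1)]
    by auto
  have "int q dvd N (h + of_int (int q) * y) - N h" by (rule N_cong[OF hS y(1)])
  also have "h + of_int (int q) * y = g" unfolding h_def g_def y(2) by simp
  finally have "int q dvd (N g - N h) - (N g - D)" using qND by (rule dvd_diff)
  then have qD: "int q dvd D - N h" by simp
  have "of_int (N \<delta> - N h) = (of_int ((N \<alpha> - 1) * (N \<beta> - 1)) :: 'a)"
  proof -
    have c\<delta>: "conjugate \<delta> = 1 - conjugate \<alpha> * conjugate \<beta>" unfolding \<delta>_def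
      using \<alpha> \<beta> by (simp add: conj_diff conj_mult conj_one fld.mem_intros integers_fieldD)
    have ch: "conjugate h = \<alpha> - conjugate \<beta>" unfolding h_def
      using \<alpha> \<beta> by (simp add: conj_diff conj_conj conj_mem_field integers_fieldD)
    have "of_int (N \<delta> - N h) = \<delta> * conjugate \<delta> - h * conjugate h"
      using \<delta>S hS by (simp add: mult_conjugate_N)
    also have "\<dots> = (\<alpha> * conjugate \<alpha> - 1) * (\<beta> * conjugate \<beta> - 1)"
      unfolding c\<delta> ch unfolding \<delta>_def h_def by (simp add: algebra_simps)
    finally show ?thesis using \<alpha> \<beta> by (simp add: mult_conjugate_N)
  qed
  then have "N \<delta> - N h = (N \<alpha> - 1) * (N \<beta> - 1)" by (simp only: of_int_eq_iff)
  moreover have "(N \<alpha> - 1) * (N \<beta> - 1) > 0" using N\<alpha> N\<beta> by simp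
  moreover have "N \<delta> \<le> D" using \<delta>_D D by (rule zdvd_imp_le)
  moreover have "D \<le> T" using D_T T by (rule zdvd_imp_le)
  moreover have "N h \<ge> 0" by (rule N_nonneg[OF hS])
  \<comment> \<open>From \<open>N h < N \<delta> \<le> D \<le> T < q\<close>; but \<open>q\<close>
    divides \<open>D - N h\<close>.\<close>
  ultimately have "0 < D - N h" "D - N h < int q" using qT by linarith+
  then show False using qD zdvd_imp_le by fastforce
qed

end

section \<open>Translation to the algebra library\<close>

lemma type_algebra_simps [simp]:
  "carrier ring_of_type_algebra = UNIV" "x \<otimes>\<^bsub>ring_of_type_algebra\<^esub> y = x * y"
  "\<one>\<^bsub>ring_of_type_algebra\<^esub> = 1" "\<zero>\<^bsub>ring_of_type_algebra\<^esub> = 0"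
  "x \<oplus>\<^bsub>ring_of_type_algebra\<^esub> y = x + y"
  by (simp_all add: ring_of_type_algebra_def)

lemma dimension_2_Rats:
  fixes K :: "'a::field_char_0 set"
  assumes "ring.dimension ring_of_type_algebra 2 \<rat> K"
  obtains v w where "w \<noteq> 0" "v \<notin> {l * w | l. l \<in> \<rat>}" "K = {k * v + l * w | k l. k \<in> \<rat> \<and> l \<in> \<rat>}"
proof -
  interpret R: ring "ring_of_type_algebra :: 'a ring" by (rule ring_from_type_algebra)
  have ext: "R.line_extension \<rat> v E = {k * v + e | k e. k \<in> \<rat> \<and> e \<in> E}" for v :: 'a and E
    by (rule Set.set_eqI) (simp add: R.line_extension_mem_iff, blast)
  have "R.dimension (Suc (Suc 0)) \<rat> K" using assms by (simp add: numeral_2_eq_2)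
  then obtain v E where v: "R.dimension (Suc 0) \<rat> E" "v \<notin> E" "K = R.line_extension \<rat> v E"
    by (cases rule: R.dimension.cases) auto
  from v(1) obtain w E' where w: "R.dimension 0 \<rat> E'" "w \<notin> E'" "E = R.line_extension \<rat> w E'"
    by (cases rule: R.dimension.cases) auto
  from w(1) have E': "E' = {0}" by (cases rule: R.dimension.cases) auto
  have E: "E = {l * w | l. l \<in> \<rat>}" unfolding w(3) ext E' by auto
  show ?thesis
  proof (rule that)
    show "w \<noteq> 0" using w(2) E' by auto
    show "v \<notin> {l * w | l. l \<in> \<rat>}" using v(2) E by simp
    show "K = {k * v + l * w | k l. k \<in> \<rat> \<and> l \<in> \<rat>}" unfolding v(3) ext E by blast
  qed
qed

text \<open>For \<open>x\<close> in \<open>K\<close> outside the rationals, \<open>1\<close> and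
  \<open>x\<close> form a basis; completing the square gives \<open>t\<close> with rational square
  \<open>d\<close>. If \<open>d\<close> were nonnegative, sending \<open>t\<close> to
  \<open>sqrt d\<close> would embed \<open>K\<close> into the reals. The denominator of
  \<open>d\<close> scales \<open>t\<close> to \<open>\<theta>\<close>.\<close>

lemma imaginary_quadratic_field_generator:
  fixes K :: "'a::field_char_0 set"
  assumes "imaginary_quadratic_field K"
  obtains \<theta> m where "\<theta> * \<theta> = - of_nat m" "m > 0" "K = {of_rat r + of_rat s * \<theta> | r s. True}"
proof -
  interpret R: ring "ring_of_type_algebra :: 'a ring" by (rule ring_from_type_algebra)
  have sub: "subfield K ring_of_type_algebra"
    and dim: "ring.dimension ring_of_type_algebra 2 \<rat> K"
    and nohom: "ring_hom (ring_of_type_algebra\<lparr>carrier := K\<rparr>) (ring_of_type_algebra :: real ring) = {}"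
    using assms unfolding imaginary_quadratic_field_def by auto
  have one: "1 \<in> K" and mult: "\<And>x y. x \<in> K \<Longrightarrow> y \<in> K \<Longrightarrow> x * y \<in> K"
    using subfield.axioms(1)[OF sub] subringE[OF subfieldE(1)[OF sub]] by auto
  obtain v w where w: "w \<noteq> 0" and v: "v \<notin> {l * w | l. l \<in> \<rat>}"
    and K: "K = {k * v + l * w | k l. k \<in> \<rat> \<and> l \<in> \<rat>}"
    using dimension_2_Rats[OF dim] .
  have "v = 1 * v + 0 * w" "w = 0 * v + 1 * w" by simp_all
  then have vK: "v \<in> K" and wK: "w \<in> K" unfolding K by (blast intro: Rats_0 Rats_1)+
  obtain x where x: "x \<in> K" "x \<notin> \<rat>"
  proof -
    have "\<not> (v \<in> \<rat> \<and> w \<in> \<rat>)"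
    proof
      assume "v \<in> \<rat> \<and> w \<in> \<rat>"
      then have "v / w \<in> \<rat>" "v = (v / w) * w" using w by auto
      then show False using v by blast
    qed
    then show ?thesis using that vK wK by blast
  qed
  obtain k l where 1: "1 = k * v + l * w" "k \<in> \<rat>" "l \<in> \<rat>" using one unfolding K by blast
  obtain k' l' where 2: "x = k' * v + l' * w" "k' \<in> \<rat>" "l' \<in> \<rat>" using x(1) unfolding K by blast
  \<comment> \<open>The determinant of \<open>1\<close> and \<open>x\<close> in the basis
    \<open>v\<close>, \<open>w\<close>; Cramer's rule then expresses \<open>v\<close> and
    \<open>w\<close> by \<open>1\<close> and \<open>x\<close>.\<close>
  define \<Delta> where "\<Delta> = k * l' - k' * l"
  have \<Delta>v: "\<Delta> * v = l' - l * x"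
  proof -
    have "l' * 1 - l * x = l' * (k * v + l * w) - l * (k' * v + l' * w)" by (simp flip: 1(1) 2(1))
    then show ?thesis by (simp add: \<Delta>_def algebra_simps)
  qed
  have \<Delta>w: "\<Delta> * w = k * x - k'"
  proof -
    have "k * x - k' * 1 = k * (k' * v + l' * w) - k' * (k * v + l * w)" by (simp flip: 1(1) 2(1))
    then show ?thesis by (simp add: \<Delta>_def algebra_simps)
  qed
  have \<Delta>0: "\<Delta> \<noteq> 0"
  proof
    assume "\<Delta> = 0"
    then have "l * x = l'" "k * x = k'" using \<Delta>v \<Delta>w by auto
    moreover have "l \<noteq> 0 \<or> k \<noteq> 0" using 1(1) by auto
    ultimately have "x = l' / l \<or> x = k' / k" by (auto simp: field_simps)
    then show False using x(2) 1 2 Rats_divide by blast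
  qed
  have \<Delta>Q: "\<Delta> \<in> \<rat>" unfolding \<Delta>_def using 1 2 by auto
  have span: "\<exists>a b. y = of_rat a + of_rat b * x" if y: "y \<in> K" for y
  proof -
    obtain p r where p: "y = p * v + r * w" "p \<in> \<rat>" "r \<in> \<rat>" using y unfolding K by blast
    have "\<Delta> * y = p * (\<Delta> * v) + r * (\<Delta> * w)" unfolding p(1) by (simp add: algebra_simps)
    also have "\<dots> = (p * l' - r * k') + (r * k - p * l) * x"
      unfolding \<Delta>v \<Delta>w by (simp add: algebra_simps)
    finally have \<Delta>y: "\<Delta> * y = (p * l' - r * k') + (r * k - p * l) * x" .
    have "y = \<Delta> * y / \<Delta>" using \<Delta>0 by simp
    also have "\<dots> = (p * l' - r * k') / \<Delta> + (r * k - p * l) / \<Delta> * x"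
      unfolding \<Delta>y by (simp add: add_divide_distrib)
    finally have "y = (p * l' - r * k') / \<Delta> + (r * k - p * l) / \<Delta> * x" .
    moreover have "(p * l' - r * k') / \<Delta> \<in> \<rat>" "(r * k - p * l) / \<Delta> \<in> \<rat>" using 1 2 p \<Delta>Q by auto
    then obtain r1 r2 where "(p * l' - r * k') / \<Delta> = of_rat r1" "(r * k - p * l) / \<Delta> = of_rat r2"
      by (elim Rats_cases)
    ultimately show ?thesis by auto
  qed
  have lin: "of_rat a + of_rat b * x \<in> K" for a b
  proof -
    have "of_rat a + of_rat b * x = of_rat a * (k * v + l * w) + of_rat b * (k' * v + l' * w)"
      by (simp flip: 1(1) 2(1))
    also have "\<dots> = (of_rat a * k + of_rat b * k') * v + (of_rat a * l + of_rat b * l') * w"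
      by (simp add: algebra_simps)
    also have "\<dots> \<in> K" unfolding K using 1 2 by (blast intro: Rats_add Rats_mult Rats_of_rat)
    finally show ?thesis .
  qed
  obtain a b where xx: "x * x = of_rat a + of_rat b * x" using span[OF mult[OF x(1) x(1)]] by blast
  define t where "t = x - of_rat (b / 2)"
  define d where "d = a + b * b / 4"
  have tt: "t * t = of_rat d"
    unfolding t_def d_def using xx by (simp add: algebra_simps of_rat_add of_rat_mult of_rat_divide)
  have xt: "x = t + of_rat (b / 2)" by (simp add: t_def)
  have tQ: "t \<notin> \<rat>"
  proof
    assume "t \<in> \<rat>"
    then have "t + of_rat (b / 2) \<in> \<rat>" by (rule Rats_add) (rule Rats_of_rat)
    then show False using x(2) xt by simp
  qed
  have K2: "K = {of_rat r + of_rat s * t | r s. True}"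
  proof (intro equalityI subsetI)
    fix y assume "y \<in> K"
    then obtain r s where "y = of_rat r + of_rat s * x" using span by blast
    then have "y = of_rat (r + s * b / 2) + of_rat s * t"
      unfolding xt by (simp add: algebra_simps of_rat_add of_rat_mult of_rat_divide)
    then show "y \<in> {of_rat r + of_rat s * t | r s. True}" by blast
  next
    fix y assume "y \<in> {of_rat r + of_rat s * t | r s. True}"
    then obtain r s where "y = of_rat r + of_rat s * t" by blast
    then have "y = of_rat (r - s * b / 2) + of_rat s * x"
      unfolding t_def by (simp add: algebra_simps of_rat_diff of_rat_mult of_rat_divide)
    then show "y \<in> K" using lin by simp
  qed
  have uniq: "r = r' \<and> s = s'" if "of_rat r + of_rat s * t = of_rat r' + of_rat s' * t" for r s r' s'
  proof -
    have e: "of_rat (s - s') * t = of_rat (r' - r)" using that by (simp add: of_rat_diff algebra_simps)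
    have "s = s'"
    proof (rule ccontr)
      assume "s \<noteq> s'"
      then have "t = of_rat ((r' - r) / (s - s'))" using e by (simp add: of_rat_divide of_rat_diff field_simps)
      then show False using tQ by auto
    qed
    then show ?thesis using e by simp
  qed
  have d: "d < 0"
  proof (rule ccontr)
    assume "\<not> d < 0"
    then have sq: "sqrt (of_rat d) * sqrt (of_rat d) = of_rat d" by simp
    \<comment> \<open>Well defined by \<open>uniq\<close>, the uniqueness of coordinates with
      respect to \<open>1\<close> and \<open>t\<close>.\<close>
    define f where "f y = (THE z :: real. \<exists>r s. y = of_rat r + of_rat s * t \<and> z = of_rat r + of_rat s * sqrt (of_rat d))" for y
    have f: "f (of_rat r + of_rat s * t) = of_rat r + of_rat s * sqrt (of_rat d)" for r s
      unfolding f_def by (rule the_equality) (auto dest!: uniq)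
    have "f \<in> ring_hom (ring_of_type_algebra\<lparr>carrier := K\<rparr>) (ring_of_type_algebra :: real ring)"
    proof (rule ring_hom_memI)
      fix y z assume "y \<in> carrier (ring_of_type_algebra\<lparr>carrier := K\<rparr>)" "z \<in> carrier (ring_of_type_algebra\<lparr>carrier := K\<rparr>)"
      then obtain r s r' s' where y: "y = of_rat r + of_rat s * t" and z: "z = of_rat r' + of_rat s' * t"
        unfolding K2 by auto
      have "y * z = of_rat r * of_rat r' + of_rat s * of_rat s' * (t * t) + (of_rat r * of_rat s' + of_rat s * of_rat r') * t"
        unfolding y z by (simp add: algebra_simps)
      then have yz: "y * z = of_rat (r * r' + s * s' * d) + of_rat (r * s' + s * r') * t"
        unfolding tt by (simp add: of_rat_add of_rat_mult)
      have "f y * f z = of_rat r * of_rat r' + of_rat s * of_rat s' * (sqrt (of_rat d) * sqrt (of_rat d))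
         + (of_rat r * of_rat s' + of_rat s * of_rat r') * sqrt (of_rat d)"
        unfolding y z f by (simp add: algebra_simps)
      then have "f (y * z) = f y * f z" unfolding yz f sq by (simp add: of_rat_add of_rat_mult)
      then show "f (y \<otimes>\<^bsub>ring_of_type_algebra\<lparr>carrier := K\<rparr>\<^esub> z) = f y \<otimes>\<^bsub>ring_of_type_algebra\<^esub> f z" by simp
      have yz: "y + z = of_rat (r + r') + of_rat (s + s') * t"
        unfolding y z by (simp add: algebra_simps of_rat_add)
      have "f (y + z) = f y + f z" unfolding yz unfolding y z f by (simp add: algebra_simps of_rat_add)
      then show "f (y \<oplus>\<^bsub>ring_of_type_algebra\<lparr>carrier := K\<rparr>\<^esub> z) = f y \<oplus>\<^bsub>ring_of_type_algebra\<^esub> f z" by simp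
    next
      show "f \<one>\<^bsub>ring_of_type_algebra\<lparr>carrier := K\<rparr>\<^esub> = \<one>\<^bsub>ring_of_type_algebra\<^esub>" using f[of 1 0] by simp
    qed simp
    then show False using nohom by blast
  qed
  obtain i j where ij: "quotient_of d = (i, j)" by (cases "quotient_of d")
  have j: "j > 0" "d = of_int i / of_int j" using quotient_of_denom_pos[OF ij] quotient_of_div[OF ij] by auto
  have i: "i < 0" using d j by (simp add: field_simps)
  show ?thesis
  proof (rule that[of "of_int j * t" "nat (- (i * j))"])
    have "(of_int j * t) * (of_int j * t) = of_int j * of_int j * (t * t)" by (simp add: mult_ac)
    also have "\<dots> = of_int (i * j)" unfolding tt j(2) using j(1) by (simp add: of_rat_divide)
    also have "\<dots> = - of_nat (nat (- (i * j)))" using i j by (simp add: mult_neg_pos less_imp_le)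
    finally show "(of_int j * t) * (of_int j * t) = - of_nat (nat (- (i * j)))" .
    show "nat (- (i * j)) > 0" using i j by (simp add: mult_neg_pos)
    show "K = {of_rat r + of_rat s * (of_int j * t) | r s. True}"
    proof (unfold K2, intro equalityI subsetI)
      fix y assume "y \<in> {of_rat r + of_rat s * t | r s. True}"
      then obtain r s where "y = of_rat r + of_rat s * t" by blast
      then have "y = of_rat r + of_rat (s / of_int j) * (of_int j * t)" using j(1) by (simp add: of_rat_divide)
      then show "y \<in> {of_rat r + of_rat s * (of_int j * t) | r s. True}" by blast
    next
      fix y assume "y \<in> {of_rat r + of_rat s * (of_int j * t) | r s. True}"
      then obtain r s where "y = of_rat r + of_rat s * (of_int j * t)" by blast
      then have "y = of_rat r + of_rat (s * of_int j) * t" by (simp add: of_rat_mult)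
      then show "y \<in> {of_rat r + of_rat s * t | r s. True}" by blast
    qed
  qed
qed

section \<open>Generated subgroups of the residue units\<close>

text \<open>Bezout's \<open>u * q + v * e = 1\<close> recovers \<open>a\<close> as the
  \<open>u\<close>-th power of \<open>a [^] q\<close>.\<close>

lemma (in group) generate_eq_of_coprime_power:
  fixes q e :: nat
  assumes a: "a \<in> carrier G" and e: "a [^] e = \<one>" and q: "coprime q e"
  shows "generate G {a} = generate G {a [^] q}"
proof
  have sub: "subgroup (generate G {x}) G" if "x \<in> carrier G" for x
    using that by (intro generate_is_subgroup) simp
  have pow: "x [^] (k::int) \<in> generate G {x}" if "x \<in> carrier G" for x k
    using that generate_pow[of x] by auto
  show "generate G {a [^] q} \<subseteq> generate G {a}"
    using pow[OF a, of "int q"] by (intro generate_subgroup_incl sub a) (simp add: int_pow_int)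
  obtain u v where "u * int q + v * int e = 1"
    using q by (metis coprime_iff_gcd_eq_1 bezout_int gcd_int_int_eq of_nat_1)
  then have "a = a [^] (int q * u + int e * v)" using a by (simp add: mult.commute)
  also have "\<dots> = (a [^] int q) [^] u \<otimes> (a [^] int e) [^] v"
    using a by (simp add: int_pow_mult int_pow_pow)
  also have "\<dots> = (a [^] q) [^] u" using a e by (simp add: int_pow_int)
  finally have "a = (a [^] q) [^] u" .
  then have "a \<in> generate G {a [^] q}" using pow[of "a [^] q" u] a by simp
  then show "generate G {a} \<subseteq> generate G {a [^] q}"
    using a by (intro generate_subgroup_incl sub) auto
qed

context prime_ideal_set
begin

abbreviation "SR \<equiv> ring_of_type_algebra\<lparr>carrier := S\<rparr>"

lemma cring_subring: "cring SR"
proof (rule cringI)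
  show "abelian_group SR"
  proof (rule abelian_groupI)
    fix x assume "x \<in> carrier SR"
    then show "\<exists>y\<in>carrier SR. y \<oplus>\<^bsub>SR\<^esub> x = \<zero>\<^bsub>SR\<^esub>"
      by (intro bexI[of _ "- x"]) (auto intro: mem_intros)
  qed (auto simp: add_ac intro: mem_intros)
  show "comm_monoid SR" by (rule comm_monoidI) (auto simp: mult_ac intro: mem_intros)
qed (simp add: algebra_simps)

lemma primeideal_of_prime_ideal_set: "primeideal I SR"
proof (rule primeidealI)
  interpret cring SR by (rule cring_subring)
  show "ideal I SR"
  proof (rule idealI)
    show "ring SR" by (rule ring_axioms)
    show "subgroup I (add_monoid SR)"
    proof (rule group.subgroupI)
      show "group (add_monoid SR)" by (rule add.is_group)
      fix x assume x: "x \<in> I"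
      then have "x \<in> S" using ideal_subset by blast
      then have "\<ominus>\<^bsub>SR\<^esub> x = - x" by (intro minus_equality) (auto intro: mem_intros)
      then show "inv\<^bsub>add_monoid SR\<^esub> x \<in> I" using x by (simp add: a_inv_def ideal_uminus)
    qed (use ideal_subset ideal_zero ideal_add in auto)
  qed (auto intro: ideal_mult ideal_mult')
  show "carrier SR \<noteq> I" using proper one_mem by auto
qed (use cring_subring prime_ideal in auto)

lemma coset_eq: "a - b \<in> I \<Longrightarrow> I +>\<^bsub>SR\<^esub> a = I +>\<^bsub>SR\<^esub> b"
proof -
  have *: "I +>\<^bsub>SR\<^esub> a \<subseteq> I +>\<^bsub>SR\<^esub> b" if "a - b \<in> I" for a b
  proof
    fix y assume "y \<in> I +>\<^bsub>SR\<^esub> a"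
    then obtain h where h: "h \<in> I" "y = h + a" by (auto simp: a_r_coset_def')
    then have "h + (a - b) \<in> I" using that by (intro ideal_add)
    then show "y \<in> I +>\<^bsub>SR\<^esub> b"
      using h(2) by (auto simp: a_r_coset_def' intro!: bexI[of _ "h + (a - b)"])
  qed
  assume "a - b \<in> I"
  then show ?thesis using * cong_sym by blast
qed

text \<open>The class of \<open>a\<close> is a unit of order dividing \<open>e\<close>, hence prime
  to \<open>q\<close>, so it generates the same group as its \<open>q\<close>-th power, the class of
  \<open>b\<close>.\<close>

lemma residue_subgroup_eq:
  assumes a: "a \<in> S" and b: "b \<in> S" and q: "a ^ q - b \<in> I" and e: "e > 0" "a ^ e - 1 \<in> I" and qe: "coprime q e"
  shows "residue_subgroup SR I a = residue_subgroup SR I b"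
proof -
  interpret cring SR by (rule cring_subring)
  interpret primeideal I SR by (rule primeideal_of_prime_ideal_set)
  let ?Q = "SR Quot I"
  interpret Q: cring ?Q by (rule quotient_is_cring[OF cring_subring])
  interpret U: group "units_of ?Q" by (rule Q.units_group)
  let ?c = "\<lambda>x. I +>\<^bsub>SR\<^esub> x"
  have hom: "?c \<in> ring_hom SR ?Q" by (rule rcos_ring_hom)
  have cS: "?c x \<in> carrier ?Q" if "x \<in> S" for x using ring_hom_closed[OF hom] that by simp
  have pow: "?c a [^]\<^bsub>?Q\<^esub> n = ?c (a ^ n)" for n :: nat
  proof (induction n)
    case 0
    show ?case using ring_hom_one[OF hom] by simp
  next
    case (Suc n)
    then show ?case using ring_hom_mult[OF hom, of "a ^ n" a] a by (simp add: power_mem mult.commute)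
  qed
  have ae: "?c a [^]\<^bsub>?Q\<^esub> e = \<one>\<^bsub>?Q\<^esub>"
    unfolding pow coset_eq[OF e(2)] using ring_hom_one[OF hom] by simp
  \<comment> \<open>The inverse is the power with exponent \<open>e - 1\<close>.\<close>
  have unit: "?c a \<in> Units ?Q"
  proof -
    have "?c a [^]\<^bsub>?Q\<^esub> (e - 1) \<otimes>\<^bsub>?Q\<^esub> ?c a = \<one>\<^bsub>?Q\<^esub>"
      using ae e(1) by (metis Q.nat_pow_Suc Suc_diff_1)
    then show ?thesis using cS[OF a] Q.m_comm[of "?c a" "?c a [^]\<^bsub>?Q\<^esub> (e - 1)"]
      unfolding Units_def by auto
  qed
  have upow: "?c a [^]\<^bsub>units_of ?Q\<^esub> n = ?c a [^]\<^bsub>?Q\<^esub> n" for n :: nat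
    by (rule Q.units_of_pow[OF unit])
  have "generate (units_of ?Q) {?c a} = generate (units_of ?Q) {?c a [^]\<^bsub>units_of ?Q\<^esub> q}"
    by (rule U.generate_eq_of_coprime_power[OF _ _ qe]) (simp_all add: units_of_carrier units_of_one unit upow ae)
  also have "?c a [^]\<^bsub>units_of ?Q\<^esub> q = ?c b" unfolding upow pow by (rule coset_eq[OF q])
  finally show ?thesis unfolding residue_subgroup_def .
qed

end

theorem theorem1p4:
  fixes K :: "'a::field_char_0 set" and \<alpha> \<beta> :: 'a
  assumes "imaginary_quadratic_field K"
    and "\<alpha> \<in> carrier (ring_of_integers K)" and "\<beta> \<in> carrier (ring_of_integers K)"
    and "\<alpha> \<noteq> 0" and "\<beta> \<noteq> 0"
    and "\<not> root_of_unity \<alpha>" and "\<not> root_of_unity \<beta>"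
  shows "infinite {P. primeideal P (ring_of_integers K) \<and> P \<noteq> {0} \<and> \<alpha> * \<beta> \<notin> P \<and>
           residue_subgroup (ring_of_integers K) P \<alpha> = residue_subgroup (ring_of_integers K) P \<beta>}"
    (is "infinite ?G")
proof
  assume fin: "finite ?G"
  obtain \<theta> m where "\<theta> * \<theta> = - of_nat m" "m > 0" and K: "K = {of_rat r + of_rat s * \<theta> | r s. True}"
    using imaginary_quadratic_field_generator[OF assms(1)] .
  then interpret imaginary_quadratic \<theta> m by unfold_locales
  have O: "ring_of_integers K = ring_of_type_algebra\<lparr>carrier := integers\<rparr>"
    unfolding ring_of_integers_def integers_eq K field_set_def by simp
  have \<alpha>: "\<alpha> \<in> integers" and \<beta>: "\<beta> \<in> integers" using assms(2,3) unfolding O by auto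
  have N: "N \<alpha> \<noteq> 1" "N \<beta> \<noteq> 1"
    using N_eq_1_imp_root_of_unity[OF \<alpha>] N_eq_1_imp_root_of_unity[OF \<beta>] assms(6,7)
    unfolding root_of_unity_def by auto
  \<comment> \<open>A nonzero ideal contains the positive norm of each of its nonzero elements, so
    \<open>?G\<close> can serve as the set of prime ideals to be avoided.\<close>
  have nat: "\<exists>n>0. of_nat n \<in> P" if P: "P \<in> ?G" for P
  proof -
    from P have "primeideal P (ring_of_type_algebra\<lparr>carrier := integers\<rparr>)" and ne: "P \<noteq> {0}" by (auto simp: O)
    then interpret P: primeideal P "ring_of_type_algebra\<lparr>carrier := integers\<rparr>" by simp
    have "0 \<in> P" using additive_subgroup.zero_closed[OF P.is_additive_subgroup] by simp
    then obtain x where x: "x \<in> P" "x \<noteq> 0" using ne by blast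
    have xS: "x \<in> integers" using P.a_Hcarr[OF x(1)] by simp
    have "x * conjugate x \<in> P" using P.I_r_closed[OF x(1), of "conjugate x"] conj_mem_integers[OF xS] by simp
    then have "of_nat (nat (N x)) \<in> P" using N_pos[OF xS x(2)] by (simp add: mult_conjugate_N[OF xS])
    then show ?thesis using N_pos[OF xS x(2)] by (intro exI[of _ "nat (N x)"]) simp
  qed
  obtain P q e n where P: "prime_ideal_set integers P" "P \<notin> ?G" "n > 0" "of_nat n \<in> P" "\<alpha> \<notin> P" "\<beta> \<notin> P"
    and qe: "\<alpha> ^ q - \<beta> \<in> P" "e > 0" "\<alpha> ^ e - 1 \<in> P" "coprime q e"
    using ex_prime_ideal_coprime_exponents[OF \<alpha> assms(4) N(1) \<beta> assms(5) N(2) fin nat] by blast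
  interpret P: prime_ideal_set integers P by (rule P(1))
  have "P \<noteq> {0}" using P(3,4) by auto
  moreover have "\<alpha> * \<beta> \<notin> P" using P.prime_ideal[OF \<alpha> \<beta>] P(5,6) by blast
  ultimately have "P \<in> ?G"
    using P.primeideal_of_prime_ideal_set P.residue_subgroup_eq[OF \<alpha> \<beta> qe] by (simp add: O)
  then show False using P(2) by contradiction
qed

end
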